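(* Let $H$ be a bipartite graph (with a fixed bipartition and no isolated vertices). Then $H$ is complex-norming if and only if $H$ is real-norming.
   Context: Let $\mathcal{F}_{\mathbb{R}}$ (resp. $\mathcal{F}_{\mathbb{C}}$) be the vector space of bounded measurable functions $f:[0,1]^2\to\mathbb{R}$ (resp. $f:[0,1]^2\to\mathbb{C}$). A "norm" on such a space means a seminorm $\|\cdot\|$ (over the respective field) with $\|f\|=0$ if and only if $f=0$ almost everywhere. A bipartite graph $H$ is finite, nonempty, has no isolated vertices and a fixed bipartition $V(H)=A\cup B$; every edge is written as an ordered pair $(u,v)$ with $u\in A$, $v\in B$. Assign to each $u\in A$ a variable $x_u\in[0,1]$ and to each $v\in B$ a variable $y_v\in[0,1]$, and integrate with respect to Lebesgue measure on $[0,1]^{|V(H)|}$. Define $t_H(f)=\int\prod_{(u,v)\in E(H)}f(x_u,y_v)$. A $2$-edge-colouring is a map $\alpha:E(H)\to\{0,1\}$, and $t_{H,\alpha}(f)=\int\prod_{e=(u,v)\in E(H)}f(x_u,y_v)^{\alpha(e)}\,\overline{f(x_u,y_v)}^{\,1-\alpha(e)}$ for $f\in\mathcal{F}_{\mathbb{C}}$. $H$ is real-norming if $f\mapsto|t_H(f)|^{1/e(H)}$ is a norm on $\mathcal{F}_{\mathbb{R}}$. The pair $(H,\alpha)$ is complex-norming if $f\mapsto|t_{H,\alpha}(f)|^{1/e(H)}$ is a norm on $\mathcal{F}_{\mathbb{C}}$, and $H$ is complex-norming if there is a $2$-edge-colouring $\alpha$ such that $(H,\alpha)$ is complex-norming.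 Here $e(H)=|E(H)|$. *)

theory Defs
  imports "HOL-Analysis.Analysis"
begin

definition bipartite_graph :: "'v set \<Rightarrow> 'v set \<Rightarrow> ('v \<times> 'v) set \<Rightarrow> bool" where
  "bipartite_graph A B E \<longleftrightarrow>
     finite A \<and> finite B \<and> A \<inter> B = {} \<and> A \<union> B \<noteq> {} \<and> E \<subseteq> A \<times> B \<and>
     (\<forall>w \<in> A \<union> B. \<exists>e \<in> E. w = fst e \<or> w = snd e)"

abbreviation unit_square :: "(real \<times> real) set" where
  "unit_square \<equiv> {0..1} \<times> {0..1}"

text \<open>A function on the unit square is modelled by a total function on the plane whose values
  outside the square are ignored: they enter neither the conditions below nor the integrals.\<close>

definition bdd_meas :: "(real \<times> real \<Rightarrow> 'k::real_normed_field) set" where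
  "bdd_meas = {f. f \<in> borel_measurable (lebesgue_on unit_square) \<and> bounded (f ` unit_square)}"

text \<open>The scalars are the values of the functions: the type \<open>'k\<close> is
  \<^typ>\<open>real\<close> or \<^typ>\<open>complex\<close> below.\<close>

definition is_norm :: "((real \<times> real \<Rightarrow> 'k::real_normed_field) \<Rightarrow> real) \<Rightarrow> bool" where
  "is_norm N \<longleftrightarrow>
     (\<forall>f \<in> bdd_meas. 0 \<le> N f) \<and>
     (\<forall>f \<in> bdd_meas. \<forall>g \<in> bdd_meas. N (\<lambda>p. f p + g p) \<le> N f + N g) \<and>
     (\<forall>c. \<forall>f \<in> bdd_meas. N (\<lambda>p. c * f p) = norm c * N f) \<and>
     (\<forall>f \<in> bdd_meas. N f = 0 \<longleftrightarrow> (AE p in lebesgue_on unit_square. f p = 0))"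

text \<open>Lebesgue measure on the cube with coordinates indexed by \<open>V\<close>. The completion is
  needed because \<^term>\<open>\<lambda>x. f (x u, x v)\<close> is only Lebesgue measurable for a Lebesgue
  measurable \<open>f\<close>.\<close>

definition cube_lebesgue :: "'v set \<Rightarrow> ('v \<Rightarrow> real) measure" where
  "cube_lebesgue V = completion (Pi\<^sub>M V (\<lambda>_. restrict_space lborel {0..1}))"

text \<open>The variables of the two sides form a single vector indexed by the disjoint union
  \<open>A \<union> B\<close>: the variable of \<open>u\<close> in \<open>A\<close> is \<open>x u\<close> and that of \<open>v\<close> in \<open>B\<close> is \<open>x v\<close>.\<close>

definition t_hom :: "'v set \<Rightarrow> 'v set \<Rightarrow> ('v \<times> 'v) set \<Rightarrow> (real \<times> real \<Rightarrow> real) \<Rightarrow> real" where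
  "t_hom A B E f = (\<integral>x. (\<Prod>(u, v) \<in> E. f (x u, x v)) \<partial>cube_lebesgue (A \<union> B))"

definition t_hom_col ::
  "'v set \<Rightarrow> 'v set \<Rightarrow> ('v \<times> 'v) set \<Rightarrow> ('v \<times> 'v \<Rightarrow> nat) \<Rightarrow> (real \<times> real \<Rightarrow> complex) \<Rightarrow> complex" where
  "t_hom_col A B E \<alpha> f =
     (\<integral>x. (\<Prod>(u, v) \<in> E. f (x u, x v) ^ \<alpha> (u, v) * cnj (f (x u, x v)) ^ (1 - \<alpha> (u, v)))
        \<partial>cube_lebesgue (A \<union> B))"

definition real_norming :: "'v set \<Rightarrow> 'v set \<Rightarrow> ('v \<times> 'v) set \<Rightarrow> bool" where
  "real_norming A B E \<longleftrightarrow> is_norm (\<lambda>f. root (card E) \<bar>t_hom A B E f\<bar>)"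

definition complex_norming_col ::
  "'v set \<Rightarrow> 'v set \<Rightarrow> ('v \<times> 'v) set \<Rightarrow> ('v \<times> 'v \<Rightarrow> nat) \<Rightarrow> bool" where
  "complex_norming_col A B E \<alpha> \<longleftrightarrow> is_norm (\<lambda>f. root (card E) (cmod (t_hom_col A B E \<alpha> f)))"

definition complex_norming :: "'v set \<Rightarrow> 'v set \<Rightarrow> ('v \<times> 'v) set \<Rightarrow> bool" where
  "complex_norming A B E \<longleftrightarrow> (\<exists>\<alpha>. (\<forall>e \<in> E. \<alpha> e \<in> {0, 1}) \<and> complex_norming_col A B E \<alpha>)"

end

theory Submission
  imports Defs "HOL-Probability.Probability"
begin

text \<open>Restricting a complex norm to real functions settles one direction. For the other one, step
  functions reduce everything to matrices and finite homomorphism sums. Applying the triangle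
  inequality of the real norm to sums of \<open>2 Re ((f \<otimes> cnj f)\<^sup>\<otimes>\<^sup>k)\<close> (Hatami's tensor power argument)
  yields a Hoelder inequality for \<open>N f = max\<^sub>\<alpha> \<bar>t\<^sub>\<alpha> f\<bar>\<close>, the maximum over all colourings \<open>\<alpha>\<close>. This inequality
  forces \<open>N\<close> to be multiplicative under tensor products. Hence one colouring attains the maximum for
  all matrices: otherwise the tensor product of one counterexample per colouring would have no
  extremal colouring. By approximation the Hoelder inequality for this colouring extends to
  all bounded measurable functions, and the norm axioms follow from it.\<close>

section \<open>Homomorphism sums, colours and tensor products of matrices\<close>

text \<open>Every edge carries its own matrix, because the Hoelder inequality below compares mixed
  sums with sums of a single matrix.\<close>

definition hom_sum ::
  "'v set \<Rightarrow> ('v \<times> 'v) set \<Rightarrow> nat \<Rightarrow> ('v \<times> 'v \<Rightarrow> nat \<Rightarrow> nat \<Rightarrow> complex) \<Rightarrow> complex" where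
  "hom_sum V E n F = (\<Sum>x \<in> V \<rightarrow>\<^sub>E {..<n}. \<Prod>e \<in> E. F e (x (fst e)) (x (snd e)))"

text \<open>Boolean colours compose by equality, as a group of order two, so that flipping all
  colours is one more conjugation.\<close>

definition conj_unless :: "bool \<Rightarrow> complex \<Rightarrow> complex" where
  "conj_unless b z = (if b then z else cnj z)"

definition conj_mat :: "bool \<Rightarrow> (nat \<Rightarrow> nat \<Rightarrow> complex) \<Rightarrow> nat \<Rightarrow> nat \<Rightarrow> complex" where
  "conj_mat b a = (\<lambda>i j. conj_unless b (a i j))"

text \<open>The Kronecker product: an index below \<open>n * k\<close> encodes the pair of its
  quotient and remainder on division by \<open>k\<close>.\<close>

definition tensor ::
  "nat \<Rightarrow> (nat \<Rightarrow> nat \<Rightarrow> complex) \<Rightarrow> (nat \<Rightarrow> nat \<Rightarrow> complex) \<Rightarrow> nat \<Rightarrow> nat \<Rightarrow> complex" where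
  "tensor k a b = (\<lambda>i j. a (i div k) (j div k) * b (i mod k) (j mod k))"

primrec tensor_power :: "nat \<Rightarrow> (nat \<Rightarrow> nat \<Rightarrow> complex) \<Rightarrow> nat \<Rightarrow> nat \<Rightarrow> nat \<Rightarrow> complex" where
  "tensor_power n a 0 = (\<lambda>i j. 1)"
| "tensor_power n a (Suc k) = tensor (n ^ k) a (tensor_power n a k)"

lemma conj_unless_simps [simp]:
  "conj_unless True z = z" "conj_unless False z = cnj z"
  by (simp_all add: conj_unless_def)

lemma norm_conj_unless [simp]: "cmod (conj_unless b z) = cmod z"
  by (simp add: conj_unless_def)

lemma conj_unless_conj_unless: "conj_unless b (conj_unless c z) = conj_unless (b = c) z"
  by (simp add: conj_unless_def)

lemma conj_unless_mult: "conj_unless b (y * z) = conj_unless b y * conj_unless b z"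
  by (simp add: conj_unless_def)

lemma conj_unless_add: "conj_unless b (y + z) = conj_unless b y + conj_unless b z"
  by (simp add: conj_unless_def)

lemma conj_unless_of_real [simp]: "conj_unless b (of_real r) = of_real r"
  by (simp add: conj_unless_def)

lemma conj_mat_True [simp]: "conj_mat True a = a"
  by (simp add: conj_mat_def)

lemma conj_mat_conj_mat: "conj_mat b (conj_mat c a) = conj_mat (b = c) a"
  by (simp add: conj_mat_def conj_unless_conj_unless)

lemma conj_mat_tensor: "conj_mat b (tensor k a a') = tensor k (conj_mat b a) (conj_mat b a')"
  by (simp add: conj_mat_def tensor_def conj_unless_mult)

lemma conj_mat_tensor_power: "conj_mat b (tensor_power n a k) = tensor_power n (conj_mat b a) k"
  by (induction k) (simp_all add: conj_mat_tensor, simp add: conj_mat_def conj_unless_def)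

text \<open>Quotient and remainder split an assignment into \<open>{..<n * k}\<close> into a pair of
  independent assignments, and the product over the edges splits accordingly.\<close>

lemma hom_sum_tensor:
  assumes "0 < k" "E \<subseteq> V \<times> V"
  shows "hom_sum V E (n * k) (\<lambda>e. tensor k (F e) (G e)) = hom_sum V E n F * hom_sum V E k G"
proof -
  have lt: "a * k + b < n * k" if "a < n" "b < k" for a b
  proof -
    have "a * k + b < Suc a * k" using that by simp
    also have "\<dots> \<le> n * k" using that by (intro mult_le_mono1) simp
    finally show ?thesis .
  qed
  let ?f = "\<lambda>(x, y). \<lambda>v\<in>V. x v * k + y v"
  let ?g = "\<lambda>z. (\<lambda>v\<in>V. z v div k, \<lambda>v\<in>V. z v mod k)"
  show ?thesis
    unfolding hom_sum_def sum_product sum.cartesian_product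
  proof (rule sum.reindex_bij_witness[where i = ?f and j = ?g])
    fix z assume z: "z \<in> V \<rightarrow>\<^sub>E {..<n * k}"
    show "?f (?g z) = z"
      using z by (auto simp: fun_eq_iff PiE_def extensional_def)
    show "?g z \<in> (V \<rightarrow>\<^sub>E {..<n}) \<times> (V \<rightarrow>\<^sub>E {..<k})"
      using z assms by (auto simp: PiE_iff less_mult_imp_div_less)
  next
    fix p assume p: "p \<in> (V \<rightarrow>\<^sub>E {..<n}) \<times> (V \<rightarrow>\<^sub>E {..<k})"
    obtain x y where [simp]: "p = (x, y)" by (cases p)
    have xy: "x \<in> V \<rightarrow>\<^sub>E {..<n}" "y \<in> V \<rightarrow>\<^sub>E {..<k}" using p by auto
    have "x v < n" "y v < k" if "v \<in> V" for v using xy that by auto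
    then show "?f p \<in> V \<rightarrow>\<^sub>E {..<n * k}"
      using lt by (auto simp: PiE_iff)
    have "restrict (\<lambda>v. (x v * k + y v) div k) V = x" "restrict (\<lambda>v. (x v * k + y v) mod k) V = y"
      using xy assms by (auto simp: fun_eq_iff PiE_iff extensional_def)
    moreover have "?g (?f p) = (restrict (\<lambda>v. (x v * k + y v) div k) V, restrict (\<lambda>v. (x v * k + y v) mod k) V)"
      by (auto simp: fun_eq_iff)
    ultimately show "?g (?f p) = p" by simp
  next
    fix z assume z: "z \<in> V \<rightarrow>\<^sub>E {..<n * k}"
    show "(case ?g z of (x, y) \<Rightarrow>
        (\<Prod>e\<in>E. F e (x (fst e)) (x (snd e))) * (\<Prod>e\<in>E. G e (y (fst e)) (y (snd e)))) =
      (\<Prod>e\<in>E. tensor k (F e) (G e) (z (fst e)) (z (snd e)))"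
      using assms(2) by (auto simp: tensor_def prod.distrib[symmetric] intro!: prod.cong)
  qed
qed


section \<open>Coloured homomorphism sums and their maximum\<close>

text \<open>Distinct ends of an edge are distinct integration variables, so their joint law is
  Lebesgue measure on the square. Nonempty \<open>E\<close> makes \<open>m\<close> positive, as the
  m-th roots require.\<close>

locale edge_system =
  fixes V :: "'v set" and E :: "('v \<times> 'v) set"
  assumes finite_V: "finite V" and finite_E: "finite E" and E_ne: "E \<noteq> {}"
    and E_sub: "E \<subseteq> V \<times> V" and loopless: "e \<in> E \<Longrightarrow> fst e \<noteq> snd e"
begin

abbreviation T :: "nat \<Rightarrow> ('v \<times> 'v \<Rightarrow> nat \<Rightarrow> nat \<Rightarrow> complex) \<Rightarrow> complex" where
  "T \<equiv> hom_sum V E"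

abbreviation m :: nat where "m \<equiv> card E"

abbreviation colourings :: "('v \<times> 'v \<Rightarrow> bool) set" where
  "colourings \<equiv> E \<rightarrow>\<^sub>E UNIV"

definition t_col :: "('v \<times> 'v \<Rightarrow> bool) \<Rightarrow> nat \<Rightarrow> (nat \<Rightarrow> nat \<Rightarrow> complex) \<Rightarrow> complex" where
  "t_col \<alpha> n a = T n (\<lambda>e. conj_mat (\<alpha> e) a)"

text \<open>The matrix form of \<open>N\<close>. Colourings are extensional on \<open>E\<close>, so
  the maximum ranges over a finite nonempty set.\<close>

definition max_col :: "nat \<Rightarrow> (nat \<Rightarrow> nat \<Rightarrow> complex) \<Rightarrow> real" where
  "max_col n a = Max ((\<lambda>\<alpha>. cmod (t_col \<alpha> n a)) ` colourings)"

lemma m_pos: "0 < m"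
  using finite_E E_ne by (simp add: card_gt_0_iff)

lemma finite_colourings: "finite colourings"
  using finite_E by (intro finite_PiE) auto

lemma colourings_ne: "colourings \<noteq> {}"
  by (simp add: PiE_eq_empty_iff)

lemma T_cong: "(\<And>e. e \<in> E \<Longrightarrow> F e = G e) \<Longrightarrow> T n F = T n G"
  unfolding hom_sum_def by (intro sum.cong prod.cong) auto

lemma T_tensor: "0 < k \<Longrightarrow> T (n * k) (\<lambda>e. tensor k (F e) (G e)) = T n F * T k G"
  using hom_sum_tensor E_sub by blast

lemma T_tensor_power:
  assumes "0 < n"
  shows "T (n ^ k) (\<lambda>e. tensor_power n (F e) k) = T n F ^ k"
proof (induction k)
  case 0
  have "card (V \<rightarrow>\<^sub>E {..<Suc 0}) = 1"
    using finite_V by (simp add: card_PiE)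
  then show ?case by (simp add: hom_sum_def)
next
  case (Suc k)
  then show ?case using assms by (simp add: T_tensor)
qed

lemma T_scale: "T n (\<lambda>e i j. c e * F e i j) = (\<Prod>e\<in>E. c e) * T n F"
  by (simp add: hom_sum_def prod.distrib sum_distrib_left)

text \<open>Multilinearity: the product of the sums expands over all choices of one summand per
  edge.\<close>

lemma T_sum:
  assumes "finite I"
  shows "T n (\<lambda>e i j. \<Sum>s\<in>I. W s e i j) = (\<Sum>\<phi>\<in>E \<rightarrow>\<^sub>E I. T n (\<lambda>e. W (\<phi> e) e))"
proof -
  have "T n (\<lambda>e i j. \<Sum>s\<in>I. W s e i j) =
      (\<Sum>x \<in> V \<rightarrow>\<^sub>E {..<n}. \<Sum>\<phi>\<in>E \<rightarrow>\<^sub>E I. \<Prod>e\<in>E. W (\<phi> e) e (x (fst e)) (x (snd e)))"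
    unfolding hom_sum_def using finite_E assms by (intro sum.cong refl prod_sum_PiE) auto
  also have "\<dots> = (\<Sum>\<phi>\<in>E \<rightarrow>\<^sub>E I. T n (\<lambda>e. W (\<phi> e) e))"
    unfolding hom_sum_def by (rule sum.swap)
  finally show ?thesis .
qed

lemma T_cnj: "T n (\<lambda>e. conj_mat False (F e)) = cnj (T n F)"
  by (simp add: hom_sum_def conj_mat_def)

text \<open>Conjugating the matrix flips the colour of every edge, which conjugates the whole
  sum.\<close>

lemma cmod_t_col_conj: "cmod (t_col \<alpha> n (conj_mat b a)) = cmod (t_col \<alpha> n a)"
proof (cases b)
  case False
  have "t_col \<alpha> n (conj_mat b a) = T n (\<lambda>e. conj_mat False (conj_mat (\<alpha> e) a))"
    using False by (simp add: t_col_def conj_mat_conj_mat)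
  then show ?thesis by (simp add: T_cnj t_col_def)
qed simp

lemma t_col_tensor: "0 < k \<Longrightarrow> t_col \<alpha> (n * k) (tensor k a b) = t_col \<alpha> n a * t_col \<alpha> k b"
  by (simp add: t_col_def conj_mat_tensor T_tensor)

lemma t_col_restrict: "t_col (restrict \<alpha> E) n a = t_col \<alpha> n a"
  unfolding t_col_def by (rule T_cong) simp

lemma t_col_le_max: "cmod (t_col \<alpha> n a) \<le> max_col n a"
proof -
  have "cmod (t_col (restrict \<alpha> E) n a) \<le> max_col n a"
    unfolding max_col_def using finite_colourings by (intro Max_ge) auto
  then show ?thesis by (simp add: t_col_restrict)
qed

lemma max_col_attained: obtains \<alpha> where "\<alpha> \<in> colourings" "cmod (t_col \<alpha> n a) = max_col n a"
proof -
  have "max_col n a \<in> (\<lambda>\<alpha>. cmod (t_col \<alpha> n a)) ` colourings"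
    unfolding max_col_def using finite_colourings colourings_ne by (intro Max_in) auto
  then show thesis by (rule imageE) (use that in metis)
qed

lemma max_col_nonneg: "0 \<le> max_col n a"
  by (rule order_trans[OF norm_ge_zero t_col_le_max])

lemma max_col_conj: "max_col n (conj_mat b a) = max_col n a"
  by (simp add: max_col_def cmod_t_col_conj)

section \<open>A Hoelder inequality for homomorphism sums\<close>

text \<open>Hatami's tensor power argument, run for all colourings at once.\<close>

lemma T_le_one:
  assumes triangle: "\<And>n a b. 0 < n \<Longrightarrow> (\<And>i j. a i j \<in> \<real>) \<Longrightarrow> (\<And>i j. b i j \<in> \<real>) \<Longrightarrow>
      root m (cmod (T n (\<lambda>e i j. a i j + b i j))) \<le>
      root m (cmod (T n (\<lambda>e. a))) + root m (cmod (T n (\<lambda>e. b)))"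
    and n: "0 < n"
    and F: "\<And>e \<alpha>. e \<in> E \<Longrightarrow> cmod (t_col \<alpha> n (F e)) \<le> 1"
  shows "cmod (T n F) \<le> 1"
proof (rule ccontr)
  assume "\<not> cmod (T n F) \<le> 1"
  then have gt: "1 < cmod (T n F) ^ 2" by (simp add: one_less_power)
  have bound: "(cmod (T n F) ^ 2) ^ k \<le> real (2 * m) ^ m" for k
  proof -
    \<comment> \<open>The index is a pair of an edge and a colour. Tensoring with the conjugate
      turns values of \<open>T\<close> into squared moduli; the tensor power amplifies them against
      a constant that does not depend on \<open>k\<close>.\<close>
    define W where "W s = conj_mat (snd s)
      (tensor_power (n * n) (tensor n (F (fst s)) (conj_mat False (F (fst s)))) k)" for s
    \<comment> \<open>Summing over both colours gives twice a real part, to which the triangle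
      inequality for real matrices applies.\<close>
    define R where "R e = (\<lambda>i j. \<Sum>b\<in>UNIV. W (e, b) i j)" for e
    let ?N = "(n * n) ^ k"
    have N: "0 < ?N" using n by simp
    \<comment> \<open>Each mixed sum is real and nonnegative, so nothing cancels when such sums are
      added.\<close>
    have TW: "T ?N (\<lambda>e. W (\<phi> e)) =
        of_real ((cmod (T n (\<lambda>e. conj_mat (snd (\<phi> e)) (F (fst (\<phi> e))))) ^ 2) ^ k)" for \<phi>
    proof -
      let ?G = "\<lambda>e. conj_mat (snd (\<phi> e)) (F (fst (\<phi> e)))"
      have "W (\<phi> e) = tensor_power (n * n) (tensor n (?G e) (conj_mat False (?G e))) k" for e
        unfolding W_def conj_mat_tensor_power conj_mat_tensor conj_mat_conj_mat
        by (metis (full_types))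
      then have "T ?N (\<lambda>e. W (\<phi> e)) = (T n ?G * cnj (T n ?G)) ^ k"
        using n by (simp add: T_tensor_power T_tensor T_cnj)
      then show ?thesis by (simp only: complex_norm_square[symmetric] of_real_power)
    qed
    have R_real: "R e i j \<in> \<real>" for e i j
      by (simp add: R_def UNIV_bool W_def conj_mat_def complex_is_Real_iff)
    have TR: "root m (cmod (T ?N (\<lambda>e'. R e))) \<le> 2" if e: "e \<in> E" for e
    proof -
      \<comment> \<open>The expansion has \<open>2 ^ m\<close> terms, each a power of some modulus
        \<open>cmod (t_col \<phi> n (F e))\<close> and hence at most 1; the m-th root turns the
        count into 2.\<close>
      have "T ?N (\<lambda>e'. R e) = (\<Sum>\<phi>\<in>colourings. T ?N (\<lambda>e'. W (e, \<phi> e')))"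
        unfolding R_def by (subst T_sum) auto
      also have "cmod \<dots> \<le> (\<Sum>\<phi>\<in>colourings. 1)"
      proof (intro order.trans[OF norm_sum] sum_mono)
        fix \<phi> :: "'v \<times> 'v \<Rightarrow> bool"
        show "cmod (T ?N (\<lambda>e'. W (e, \<phi> e'))) \<le> 1"
          using F[OF e, of \<phi>] TW[of "\<lambda>e'. (e, \<phi> e')"]
          by (simp add: t_col_def norm_power power_le_one)
      qed
      also have "\<dots> = 2 ^ m" using finite_E by (simp add: card_PiE)
      finally have "root m (cmod (T ?N (\<lambda>e'. R e))) \<le> root m (2 ^ m)"
        using m_pos by simp
      then show ?thesis using m_pos by (simp add: real_root_power_cancel)
    qed
    have sub: "root m (cmod (T ?N (\<lambda>e' i j. \<Sum>e\<in>D. R e i j))) \<le> 2 * card D"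
      if "finite D" "D \<subseteq> E" for D
      using that
    proof (induction D rule: finite_induct)
      case empty
      have "T ?N (\<lambda>e' i j. 0) = 0" using m_pos by (simp add: hom_sum_def)
      then show ?case by simp
    next
      case (insert e D)
      have "root m (cmod (T ?N (\<lambda>e' i j. R e i j + (\<Sum>e\<in>D. R e i j)))) \<le>
        root m (cmod (T ?N (\<lambda>e'. R e))) + root m (cmod (T ?N (\<lambda>e' i j. \<Sum>e\<in>D. R e i j)))"
        by (rule triangle[OF N]) (auto intro: R_real)
      also have "\<dots> \<le> 2 + 2 * card D" using insert TR[of e] by auto
      finally show ?case using insert by simp
    qed
    have "T ?N (\<lambda>e' i j. \<Sum>e\<in>E. R e i j) = T ?N (\<lambda>e' i j. \<Sum>s\<in>E \<times> UNIV. W s i j)"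
      by (simp add: R_def sum.cartesian_product)
    also have "\<dots> = (\<Sum>\<phi>\<in>E \<rightarrow>\<^sub>E E \<times> UNIV. T ?N (\<lambda>e. W (\<phi> e)))"
      using finite_E by (subst T_sum) auto
    also have "\<dots> = of_real (\<Sum>\<phi>\<in>E \<rightarrow>\<^sub>E E \<times> UNIV.
        (cmod (T n (\<lambda>e. conj_mat (snd (\<phi> e)) (F (fst (\<phi> e))))) ^ 2) ^ k)"
      unfolding TW by simp
    finally have eq: "cmod (T ?N (\<lambda>e' i j. \<Sum>e\<in>E. R e i j)) = (\<Sum>\<phi>\<in>E \<rightarrow>\<^sub>E E \<times> UNIV.
        (cmod (T n (\<lambda>e. conj_mat (snd (\<phi> e)) (F (fst (\<phi> e))))) ^ 2) ^ k)"
      by (simp only: norm_of_real) (simp add: sum_nonneg)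
    define \<iota> where "\<iota> = (\<lambda>e\<in>E. (e, True))"
    have "(cmod (T n F) ^ 2) ^ k = (cmod (T n (\<lambda>e. conj_mat (snd (\<iota> e)) (F (fst (\<iota> e))))) ^ 2) ^ k"
      by (subst T_cong[of F]) (auto simp: \<iota>_def)
    also have "\<dots> \<le> cmod (T ?N (\<lambda>e' i j. \<Sum>e\<in>E. R e i j))"
      unfolding eq using finite_E by (intro member_le_sum) (auto simp: \<iota>_def intro!: finite_PiE)
    finally have "(cmod (T n F) ^ 2) ^ k \<le> cmod (T ?N (\<lambda>e' i j. \<Sum>e\<in>E. R e i j))" .
    also have "\<dots> = root m (cmod (T ?N (\<lambda>e' i j. \<Sum>e\<in>E. R e i j))) ^ m"
      using m_pos by simp
    also have "\<dots> \<le> real (2 * m) ^ m"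
      using sub[OF finite_E] m_pos by (intro power_mono) auto
    finally show ?thesis by simp
  qed
  \<comment> \<open>Powers of a number above 1 cannot stay below a bound that is uniform in
    \<open>k\<close>.\<close>
  show False
    using bound real_arch_pow[OF gt, of "real (2 * m) ^ m"] by (meson not_le)
qed


text \<open>By homogeneity this reduces to \<open>T_le_one\<close>: dividing \<open>F e\<close> by
  an m-th root normalises all its coloured sums. Adding \<epsilon> keeps the root positive when the
  maximum is 0, and \<epsilon> tends to 0 at the end.\<close>

lemma T_le_max_col:
  assumes triangle: "\<And>n a b. 0 < n \<Longrightarrow> (\<And>i j. a i j \<in> \<real>) \<Longrightarrow> (\<And>i j. b i j \<in> \<real>) \<Longrightarrow>
      root m (cmod (T n (\<lambda>e i j. a i j + b i j))) \<le>
      root m (cmod (T n (\<lambda>e. a))) + root m (cmod (T n (\<lambda>e. b)))"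
    and n: "0 < n"
  shows "cmod (T n F) ^ m \<le> (\<Prod>e\<in>E. max_col n (F e))"
proof -
  have "cmod (T n F) ^ m \<le> (\<Prod>e\<in>E. max_col n (F e) + \<epsilon>)" if \<epsilon>: "0 < \<epsilon>" for \<epsilon>
  proof -
    define r where "r e = root m (max_col n (F e) + \<epsilon>)" for e
    have r_m: "r e ^ m = max_col n (F e) + \<epsilon>" for e
      using m_pos \<epsilon> max_col_nonneg[of n "F e"] by (simp add: r_def)
    have r_pos: "0 < r e" for e
      using m_pos \<epsilon> max_col_nonneg[of n "F e"] by (simp add: r_def)
    have "cmod (T n (\<lambda>e i j. of_real (inverse (r e)) * F e i j)) \<le> 1"
    proof (rule T_le_one[OF triangle n])
      fix e \<alpha>
      have "t_col \<alpha> n (\<lambda>i j. of_real (inverse (r e)) * F e i j) =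
          T n (\<lambda>e' i j. of_real (inverse (r e)) * conj_mat (\<alpha> e') (F e) i j)"
        by (simp add: t_col_def conj_mat_def conj_unless_mult del: of_real_inverse)
      also have "\<dots> = of_real (inverse (r e) ^ m) * t_col \<alpha> n (F e)"
        by (simp add: T_scale t_col_def)
      also have "cmod \<dots> = inverse (r e ^ m) * cmod (t_col \<alpha> n (F e))"
        using r_pos[of e] by (simp add: norm_mult norm_power norm_inverse power_inverse)
      also have "\<dots> \<le> inverse (r e ^ m) * r e ^ m"
        using t_col_le_max[of \<alpha> n "F e"] r_pos[of e] \<epsilon> r_m[of e] max_col_nonneg[of n "F e"]
        by (intro mult_left_mono) (simp_all add: less_imp_le)
      also have "\<dots> = 1" using r_pos[of e] by simp
      finally show "cmod (t_col \<alpha> n (\<lambda>i j. of_real (inverse (r e)) * F e i j)) \<le> 1" .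
    qed
    also have "T n (\<lambda>e i j. of_real (inverse (r e)) * F e i j) = of_real (\<Prod>e\<in>E. inverse (r e)) * T n F"
      unfolding of_real_prod by (rule T_scale)
    also have "cmod \<dots> = (\<Prod>e\<in>E. inverse (r e)) * cmod (T n F)"
      unfolding norm_mult norm_of_real using r_pos by (simp add: abs_prod less_imp_le)
    finally have "(\<Prod>e\<in>E. r e) * ((\<Prod>e\<in>E. inverse (r e)) * cmod (T n F)) \<le> (\<Prod>e\<in>E. r e) * 1"
      using r_pos by (intro mult_left_mono prod_nonneg) (auto simp: less_imp_le)
    moreover have "(\<Prod>e\<in>E. r e) * (\<Prod>e\<in>E. inverse (r e)) = 1"
      using r_pos by (simp add: less_imp_neq[symmetric] flip: prod.distrib)
    ultimately have "cmod (T n F) \<le> (\<Prod>e\<in>E. r e)" by (simp flip: mult.assoc)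
    then have "cmod (T n F) ^ m \<le> (\<Prod>e\<in>E. r e) ^ m" by (intro power_mono) auto
    then show ?thesis by (simp add: prod_power_distrib r_m)
  qed
  moreover have "((\<lambda>\<epsilon>. \<Prod>e\<in>E. max_col n (F e) + \<epsilon>) \<longlongrightarrow> (\<Prod>e\<in>E. max_col n (F e) + 0)) (at_right 0)"
    by (intro tendsto_intros)
  ultimately have "cmod (T n F) ^ m \<le> (\<Prod>e\<in>E. max_col n (F e) + 0)"
    by (intro tendsto_lowerbound) (auto intro: eventually_at_right_less[THEN eventually_mono])
  then show ?thesis by simp
qed

section \<open>Multiplicativity of the maximum and an optimal colouring\<close>

text \<open>Colour the two factors by colourings that are extremal for them. The colourings may be
  taken to agree on one edge, and then the previous bound forces the maximum of the product to
  be attained by a single colouring.\<close>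

lemma max_col_tensor:
  assumes triangle: "\<And>n a b. 0 < n \<Longrightarrow> (\<And>i j. a i j \<in> \<real>) \<Longrightarrow> (\<And>i j. b i j \<in> \<real>) \<Longrightarrow>
      root m (cmod (T n (\<lambda>e i j. a i j + b i j))) \<le>
      root m (cmod (T n (\<lambda>e. a))) + root m (cmod (T n (\<lambda>e. b)))"
    and n: "0 < n" and k: "0 < k"
  shows "max_col (n * k) (tensor k a b) = max_col n a * max_col k b"
proof (rule antisym)
  \<comment> \<open>A single colouring of the tensor product colours both factors alike, so each
    factor stays below its own maximum. The conjugations \<open>p\<close> and \<open>q\<close> do
    not change moduli.\<close>
  have le: "max_col (n * k) (tensor k (conj_mat p a) (conj_mat q b)) \<le> max_col n a * max_col k b" for p q
  proof -
    obtain \<alpha> where "cmod (t_col \<alpha> (n * k) (tensor k (conj_mat p a) (conj_mat q b))) =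
        max_col (n * k) (tensor k (conj_mat p a) (conj_mat q b))"
      using max_col_attained by blast
    moreover have "cmod (t_col \<alpha> (n * k) (tensor k (conj_mat p a) (conj_mat q b)))
        = cmod (t_col \<alpha> n a) * cmod (t_col \<alpha> k b)"
      by (simp add: t_col_tensor k norm_mult cmod_t_col_conj)
    ultimately show ?thesis
      using t_col_le_max[of \<alpha>] max_col_nonneg by (metis mult_mono norm_ge_zero)
  qed
  from le[of True True] show "max_col (n * k) (tensor k a b) \<le> max_col n a * max_col k b" by simp
  define X where "X = max_col n a * max_col k b"
  have X_nonneg: "0 \<le> X" unfolding X_def using max_col_nonneg by simp
  obtain \<alpha> where \<alpha>: "cmod (t_col \<alpha> n a) = max_col n a" using max_col_attained by blast
  obtain \<beta>' where \<beta>': "cmod (t_col \<beta>' k b) = max_col k b" using max_col_attained by blast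
  obtain e0 where e0: "e0 \<in> E" using E_ne by blast
  \<comment> \<open>If \<beta>' disagrees with \<alpha> at \<open>e0\<close>, all its colours are
    flipped. This preserves the modulus of the coloured sum.\<close>
  define \<beta> where "\<beta> e = (\<beta>' e = (\<beta>' e0 = \<alpha> e0))" for e
  have "t_col \<beta> k b = t_col \<beta>' k (conj_mat (\<beta>' e0 = \<alpha> e0) b)"
    by (simp add: t_col_def \<beta>_def conj_mat_conj_mat)
  then have \<beta>: "cmod (t_col \<beta> k b) = max_col k b" by (simp add: \<beta>' cmod_t_col_conj)
  have agree: "\<beta> e0 = \<alpha> e0" by (auto simp: \<beta>_def)
  \<comment> \<open>Different colourings on the two factors, which only a mixed sum allows; its
    modulus is exactly \<open>X\<close>.\<close>
  define P where "P e = tensor k (conj_mat (\<alpha> e) a) (conj_mat (\<beta> e) b)" for e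
  have "X ^ m = cmod (T (n * k) P) ^ m"
    unfolding P_def T_tensor[OF k] by (simp add: norm_mult X_def flip: \<alpha> \<beta> t_col_def)
  also have "\<dots> \<le> (\<Prod>e\<in>E. max_col (n * k) (P e))"
    using n k by (intro T_le_max_col[OF triangle]) auto
  also have "\<dots> = max_col (n * k) (P e0) * (\<Prod>e\<in>E - {e0}. max_col (n * k) (P e))"
    using finite_E e0 by (rule prod.remove)
  \<comment> \<open>At \<open>e0\<close> the colours agree, so \<open>P e0\<close> is the tensor
    product up to conjugation. The other \<open>m - 1\<close> factors are at most \<open>X\<close>,
    which leaves one factor \<open>X\<close> to compare with the maximum.\<close>
  also have "max_col (n * k) (P e0) = max_col (n * k) (tensor k a b)"
    by (simp add: P_def agree max_col_conj flip: conj_mat_tensor)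
  also have "max_col (n * k) (tensor k a b) * (\<Prod>e\<in>E - {e0}. max_col (n * k) (P e)) \<le>
      max_col (n * k) (tensor k a b) * (\<Prod>e\<in>E - {e0}. X)"
    unfolding P_def X_def using le by (intro mult_left_mono prod_mono) (auto simp: max_col_nonneg)
  also have "\<dots> = max_col (n * k) (tensor k a b) * X ^ (m - 1)"
    using finite_E e0 by (simp add: card_Diff_singleton)
  finally have "X * X ^ (m - 1) \<le> max_col (n * k) (tensor k a b) * X ^ (m - 1)"
    using m_pos by (simp flip: power_Suc)
  then show "max_col n a * max_col k b \<le> max_col (n * k) (tensor k a b)"
    using X_nonneg max_col_nonneg[of "n * k" "tensor k a b"]
    by (cases "X = 0") (auto simp: X_def[symmetric] zero_less_power mult_le_cancel_right)
qed

text \<open>Counterexamples are collected one colouring at a time. Tensoring with a new one keeps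
  the old strict inequalities because the maximum is multiplicative.\<close>

lemma optimal_colouring:
  assumes triangle: "\<And>n a b. 0 < n \<Longrightarrow> (\<And>i j. a i j \<in> \<real>) \<Longrightarrow> (\<And>i j. b i j \<in> \<real>) \<Longrightarrow>
      root m (cmod (T n (\<lambda>e i j. a i j + b i j))) \<le>
      root m (cmod (T n (\<lambda>e. a))) + root m (cmod (T n (\<lambda>e. b)))"
  obtains \<alpha> where "\<And>n a. 0 < n \<Longrightarrow> cmod (t_col \<alpha> n a) = max_col n a"
proof (rule ccontr)
  assume "\<not> thesis"
  then have "\<forall>\<alpha>. \<exists>n a. 0 < n \<and> cmod (t_col \<alpha> n a) \<noteq> max_col n a"
    using that by blast
  then have bad: "\<exists>n a. 0 < n \<and> cmod (t_col \<alpha> n a) < max_col n a" for \<alpha>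
    using t_col_le_max by (metis order_le_less)
  \<comment> \<open>Positivity of the maximum is carried along, since strictness survives
    multiplication by a positive factor only.\<close>
  have "\<exists>n a. 0 < n \<and> 0 < max_col n a \<and> (\<forall>\<alpha>\<in>D. cmod (t_col \<alpha> n a) < max_col n a)"
    if "finite D" for D
    using that
  proof (induction D rule: finite_induct)
    case empty
    obtain n a where "0 < n" "cmod (t_col (\<lambda>e. True) n a) < max_col n a" using bad by blast
    moreover from this have "0 < max_col n a" using norm_ge_zero order_le_less_trans by blast
    ultimately show ?case by blast
  next
    case (insert \<beta> D)
    obtain k b where k: "0 < k" and b: "cmod (t_col \<beta> k b) < max_col k b" using bad by blast
    obtain n a where n: "0 < n" "0 < max_col n a"
      and a: "\<forall>\<alpha>\<in>D. cmod (t_col \<alpha> n a) < max_col n a" using insert.IH by blast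
    have b_pos: "0 < max_col k b" using b norm_ge_zero order_le_less_trans by blast
    have mult: "max_col (n * k) (tensor k a b) = max_col n a * max_col k b"
      by (rule max_col_tensor[OF triangle n(1) k])
    have "cmod (t_col \<alpha> (n * k) (tensor k a b)) < max_col (n * k) (tensor k a b)"
      if "\<alpha> \<in> insert \<beta> D" for \<alpha>
    proof (cases "\<alpha> = \<beta>")
      case True
      \<comment> \<open>The strict factor is \<open>b\<close> for the new colouring \<beta> and
        \<open>a\<close> for those in \<open>D\<close>; the other factor contributes a weak
        inequality.\<close>
      then show ?thesis unfolding mult t_col_tensor[OF k] norm_mult
        using b n t_col_le_max[of \<beta> n a]
        by (metis mult_right_mono mult_strict_left_mono norm_ge_zero order_le_less_trans)
    next
      case False
      then have "cmod (t_col \<alpha> n a) < max_col n a" using that a by simp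
      then show ?thesis unfolding mult t_col_tensor[OF k] norm_mult
        using b_pos t_col_le_max[of \<alpha> k b]
        by (meson mult_left_mono mult_strict_right_mono norm_ge_zero order_le_less_trans)
    qed
    moreover have "0 < n * k" "0 < max_col (n * k) (tensor k a b)"
      using n k b_pos by (auto simp: mult)
    ultimately show ?case by blast
  qed
  from this[OF finite_colourings] obtain n a
    where "\<forall>\<alpha>\<in>colourings. cmod (t_col \<alpha> n a) < max_col n a" by blast
  then show False using max_col_attained by (metis less_irrefl)
qed

end

section \<open>Lebesgue measure on the cube and its two-coordinate marginals\<close>

abbreviation unit_lborel :: "real measure" where
  "unit_lborel \<equiv> restrict_space lborel {0..1}"

lemma emeasure_unit_lborel: "A \<in> sets borel \<Longrightarrow> emeasure unit_lborel ({0..1} \<inter> A) = emeasure lborel ({0..1} \<inter> A)"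
  by (subst emeasure_restrict_space) auto

lemma prob_space_unit_lborel: "prob_space unit_lborel"
  by (rule prob_spaceI) (simp add: emeasure_restrict_space space_restrict_space)

lemma prob_space_cube_lebesgue: "prob_space (cube_lebesgue V)"
proof -
  interpret prob_space "Pi\<^sub>M V (\<lambda>_. unit_lborel)"
    by (intro prob_space_PiM prob_space_unit_lborel)
  show ?thesis
    by (rule prob_spaceI) (simp add: cube_lebesgue_def emeasure_space_1)
qed

lemma space_cube_lebesgue: "space (cube_lebesgue V) = (V \<rightarrow>\<^sub>E {0..1})"
  by (simp add: cube_lebesgue_def space_PiM space_restrict_space)

lemma unit_square_borel: "unit_square \<in> sets borel"
  by (intro borel_closed closed_Times) auto

lemma unit_square_lebesgue: "unit_square \<in> sets lebesgue"
  using unit_square_borel by (intro sets_completionI_sets) simp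

lemma measurable_cube_component:
  assumes "w \<in> V"
  shows "(\<lambda>x. x w) \<in> borel_measurable (Pi\<^sub>M V (\<lambda>_. unit_lborel))"
proof -
  have "(\<lambda>x. x w) \<in> Pi\<^sub>M V (\<lambda>_. unit_lborel) \<rightarrow>\<^sub>M unit_lborel"
    using assms by (rule measurable_component_singleton)
  then show ?thesis by (simp add: measurable_restrict_space2_iff)
qed

lemma measurable_cube_pair:
  assumes "u \<in> V" "v \<in> V"
  shows "(\<lambda>x. (x u, x v)) \<in> Pi\<^sub>M V (\<lambda>_. unit_lborel) \<rightarrow>\<^sub>M lborel"
proof -
  have "(\<lambda>x. (x u, x v)) \<in> Pi\<^sub>M V (\<lambda>_. unit_lborel) \<rightarrow>\<^sub>M borel \<Otimes>\<^sub>M borel"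
    using assms by (intro measurable_Pair measurable_cube_component)
  then show ?thesis by (simp add: borel_prod)
qed

text \<open>Two distinct coordinates are independent and uniform on the unit interval. Knowing their
  joint law allows null sets and measurability to be pulled back from the square to the
  cube.\<close>

lemma distr_PiM_pair:
  assumes V: "finite V" "u \<in> V" "v \<in> V" "u \<noteq> v"
  shows "distr (Pi\<^sub>M V (\<lambda>_. unit_lborel)) lborel (\<lambda>x. (x u, x v)) = density lborel (indicator unit_square)"
proof -
  let ?P = "Pi\<^sub>M V (\<lambda>_. unit_lborel)"
  let ?L = "density lborel (indicator {0..1}) :: real measure"
  interpret product_sigma_finite "\<lambda>_. unit_lborel"
    unfolding product_sigma_finite_def
    by (intro allI prob_space_imp_sigma_finite prob_space_unit_lborel)
  have fin: "finite_measure ?L"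
    by (rule finite_measureI) (simp add: emeasure_density)
  then have sf: "sigma_finite_measure ?L"
    by (simp add: finite_measure_def)
  have L_eq: "emeasure ?L A = emeasure unit_lborel ({0..1} \<inter> A)" if "A \<in> sets borel" for A
  proof -
    have "emeasure ?L A = (\<integral>\<^sup>+x. indicator ({0..1} \<inter> A) x \<partial>lborel)"
      using that by (simp add: emeasure_density indicator_inter_arith)
    also have "\<dots> = emeasure unit_lborel ({0..1} \<inter> A)"
      using that by (simp add: emeasure_unit_lborel)
    finally show ?thesis .
  qed
  have "?L \<Otimes>\<^sub>M ?L = distr ?P lborel (\<lambda>x. (x u, x v))"
  proof (rule pair_measure_eqI[OF sf sf])
    fix A B :: "real set" assume "A \<in> sets ?L" "B \<in> sets ?L"
    then have AB: "A \<in> sets borel" "B \<in> sets borel" by auto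
    \<comment> \<open>The rectangle pulls back to a box whose sides away from \<open>u\<close> and
      \<open>v\<close> are the full unit interval, of mass 1.\<close>
    define Q where "Q w = {0..1} \<inter> (if w = u then A else if w = v then B else UNIV)" for w
    have Q: "Q w \<in> sets unit_lborel" for w
      using AB by (auto simp: Q_def sets_restrict_space)
    have "emeasure (distr ?P lborel (\<lambda>x. (x u, x v))) (A \<times> B) = emeasure ?P ((\<lambda>x. (x u, x v)) -` (A \<times> B) \<inter> space ?P)"
      using measurable_cube_pair[OF V(2,3)] AB
      by (intro emeasure_distr) (auto simp flip: borel_prod)
    also have "(\<lambda>x. (x u, x v)) -` (A \<times> B) \<inter> space ?P = Pi\<^sub>E V Q"
      using V by (auto simp: Q_def space_PiM space_restrict_space PiE_iff split: if_splits)
    also have "emeasure ?P (Pi\<^sub>E V Q) = (\<Prod>w\<in>V. emeasure unit_lborel (Q w))"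
      using V Q by (intro emeasure_PiM) auto
    also have "\<dots> = (\<Prod>w\<in>{u, v}. emeasure unit_lborel (Q w))"
      using V emeasure_unit_lborel[of UNIV]
      by (intro prod.mono_neutral_right) (auto simp: Q_def)
    also have "\<dots> = emeasure ?L A * emeasure ?L B"
      using V AB by (simp add: Q_def L_eq)
    finally show "emeasure ?L A * emeasure ?L B = emeasure (distr ?P lborel (\<lambda>x. (x u, x v))) (A \<times> B)" ..
  next
    have "sets (?L \<Otimes>\<^sub>M ?L) = sets (borel \<Otimes>\<^sub>M borel :: (real \<times> real) measure)"
      by (intro sets_pair_measure_cong) auto
    then show "sets (?L \<Otimes>\<^sub>M ?L) = sets (distr ?P lborel (\<lambda>x. (x u, x v)))"
      by (simp only: borel_prod sets_distr sets_lborel)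
  qed
  moreover have "?L \<Otimes>\<^sub>M ?L = density (lborel \<Otimes>\<^sub>M lborel) (\<lambda>(x, y). indicator {0..1} x * indicator {0..1} y)"
    using sf by (intro pair_measure_density) (auto intro: sigma_finite_lborel)
  moreover have "(\<lambda>(x, y). indicator {0..1} x * indicator {0..1} y) = (indicator unit_square :: real \<times> real \<Rightarrow> ennreal)"
    by (auto simp: fun_eq_iff indicator_def)
  ultimately show ?thesis by (simp add: lborel_prod)
qed

lemma AE_cube_lebesgue_pair:
  assumes V: "finite V" "u \<in> V" "v \<in> V" "u \<noteq> v"
    and ae: "AE p in lebesgue_on unit_square. P p"
  shows "AE x in cube_lebesgue V. P (x u, x v)"
proof -
  have "AE p in lborel. p \<in> unit_square \<longrightarrow> P p"
    using ae by (subst (asm) AE_restrict_space_iff) (auto simp: AE_completion_iff unit_square_lebesgue)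
  then have "AE p in density lborel (indicator unit_square). P p"
    using unit_square_borel by (subst AE_density) (auto split: split_indicator elim: eventually_mono)
  then have "AE x in Pi\<^sub>M V (\<lambda>_. unit_lborel). P (x u, x v)"
    unfolding distr_PiM_pair[OF V, symmetric] by (rule AE_distrD[OF measurable_cube_pair[OF V(2,3)]])
  then show ?thesis unfolding cube_lebesgue_def by (rule AE_completion)
qed

text \<open>A Lebesgue measurable \<open>f\<close> is Borel only up to a null set, so the projection
  must pull null sets back to null sets; the law of the pair ensures this.\<close>

lemma measurable_cube_lebesgue_pair:
  fixes f :: "real \<times> real \<Rightarrow> 'b::euclidean_space"
  assumes V: "finite V" "u \<in> V" "v \<in> V" "u \<noteq> v"
    and f: "f \<in> borel_measurable (lebesgue_on unit_square)"
  shows "(\<lambda>x. f (x u, x v)) \<in> borel_measurable (cube_lebesgue V)"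
proof -
  let ?P = "Pi\<^sub>M V (\<lambda>_. unit_lborel)" and ?X = "\<lambda>x :: 'a \<Rightarrow> real. (x u, x v)"
  have X: "?X \<in> ?P \<rightarrow>\<^sub>M lborel"
    by (rule measurable_cube_pair[OF V(2,3)])
  have "?X \<in> completion ?P \<rightarrow>\<^sub>M completion lborel"
  proof (rule completion.measurable_completion2)
    show "?X \<in> completion ?P \<rightarrow>\<^sub>M lborel" using X by (rule measurable_completion)
    show "null_sets lborel \<subseteq> null_sets (distr (completion ?P) lborel ?X)"
      unfolding distr_completion[OF X] distr_PiM_pair[OF V]
    proof
      fix N :: "(real \<times> real) set" assume N: "N \<in> null_sets lborel"
      then have "N \<in> sets borel" using null_setsD2 by fastforce
      then show "N \<in> null_sets (density lborel (indicator unit_square))"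
        using unit_square_borel AE_not_in[OF N]
        by (auto simp: null_sets_density_iff elim: eventually_mono)
    qed
  qed
  \<comment> \<open>Extension by zero gives a function on the whole plane; the pairs taken from
    points of the cube lie in the square, where it equals \<open>f\<close>.\<close>
  moreover have "(\<lambda>p. if p \<in> unit_square then f p else 0) \<in> borel_measurable lebesgue"
    using f unit_square_lebesgue by (intro borel_measurable_if_I) auto
  ultimately have "(\<lambda>x. if (x u, x v) \<in> unit_square then f (x u, x v) else 0) \<in> borel_measurable (cube_lebesgue V)"
    unfolding cube_lebesgue_def by (rule measurable_compose)
  then show ?thesis
    by (rule measurable_cong[THEN iffD1, rotated])
      (use V in \<open>auto simp: space_cube_lebesgue PiE_iff\<close>)
qed


section \<open>Grid cells and step functions\<close>

text \<open>The minimum only matters at the right end point of the unit interval.\<close>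

definition cell :: "nat \<Rightarrow> real \<Rightarrow> nat" where
  "cell n x = min (nat \<lfloor>real n * x\<rfloor>) (n - 1)"

definition step_fun :: "nat \<Rightarrow> (nat \<Rightarrow> nat \<Rightarrow> complex) \<Rightarrow> real \<times> real \<Rightarrow> complex" where
  "step_fun n a p = a (cell n (fst p)) (cell n (snd p))"

lemma cell_less: "0 < n \<Longrightarrow> cell n x < n"
  by (simp add: cell_def)

lemma measurable_cell [measurable]: "cell n \<in> borel \<rightarrow>\<^sub>M count_space UNIV"
  unfolding cell_def by measurable

lemma measurable_step_fun [measurable]: "step_fun n a \<in> borel_measurable borel"
proof -
  have [measurable]: "(\<lambda>p. cell n (fst p)) \<in> (borel :: (real \<times> real) measure) \<rightarrow>\<^sub>M count_space UNIV"
    "(\<lambda>p. cell n (snd p)) \<in> (borel :: (real \<times> real) measure) \<rightarrow>\<^sub>M count_space UNIV"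
    by (intro measurable_compose[OF _ measurable_cell] borel_measurable_continuous_onI continuous_intros)+
  show ?thesis
    unfolding step_fun_def by measurable
qed

text \<open>The second bound is attained at \<open>x = 1\<close>, which belongs to the last cell
  \<open>n - 1\<close>.\<close>

lemma cell_bounds:
  assumes "0 < n" "x \<in> {0..1}"
  shows "real (cell n x) \<le> real n * x" "real n * x \<le> real (cell n x) + 1"
proof -
  have "0 \<le> real n * x" "real n * x \<le> real n" using assms by (auto simp: mult_left_le)
  then show "real (cell n x) \<le> real n * x" "real n * x \<le> real (cell n x) + 1"
    using assms(1) unfolding cell_def min_def by (auto simp: of_nat_diff; linarith)+
qed

lemma cellI:
  assumes "j < n" "real j \<le> real n * x" "real n * x < real j + 1"
  shows "cell n x = j"
proof -
  have "\<lfloor>real n * x\<rfloor> = int j" using assms by (intro floor_unique) auto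
  then show ?thesis using assms by (simp add: cell_def)
qed

text \<open>Each cell lies between a half-open and a closed interval with the same ends, both of
  length \<open>1 / n\<close>. This treats the last cell, which also contains 1, like the
  others.\<close>

lemma emeasure_cell:
  assumes "j < n"
  shows "emeasure unit_lborel ({0..1} \<inter> cell n -` {j}) = ennreal (1 / n)"
proof (rule antisym)
  have n: "0 < n" using assms by simp
  have b: "cell n -` {j} \<in> sets borel"
    using measurable_sets[OF measurable_cell, of "{j}" n] by simp
  have "{0..1} \<inter> cell n -` {j} \<subseteq> {real j / n..(real j + 1) / n}"
    using cell_bounds[OF n] n by (auto simp: field_simps)
  then have "emeasure lborel ({0..1} \<inter> cell n -` {j}) \<le> emeasure lborel {real j / n..(real j + 1) / n}"
    by (intro emeasure_mono) auto
  also have "\<dots> = ennreal (1 / n)" by (simp add: divide_right_mono flip: diff_divide_distrib)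
  finally show "emeasure unit_lborel ({0..1} \<inter> cell n -` {j}) \<le> ennreal (1 / n)"
    using b by (simp add: emeasure_unit_lborel)
  have "{real j / n..<(real j + 1) / n} \<subseteq> {0..1} \<inter> cell n -` {j}"
  proof
    fix x assume x: "x \<in> {real j / n..<(real j + 1) / n}"
    then have 1: "real j \<le> real n * x" "real n * x < real j + 1" using n by (auto simp: field_simps)
    have "real j + 1 \<le> real n" using assms by linarith
    then have "real n * x < real n * 1" using 1 by linarith
    then have "x \<le> 1" using n by simp
    moreover have "0 \<le> x" using x by (auto intro: order_trans[rotated])
    ultimately show "x \<in> {0..1} \<inter> cell n -` {j}" using cellI[OF assms 1] by simp
  qed
  then have "emeasure lborel {real j / n..<(real j + 1) / n} \<le> emeasure lborel ({0..1} \<inter> cell n -` {j})"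
    using b by (intro emeasure_mono) auto
  moreover have "emeasure lborel {real j / n..<(real j + 1) / n} = ennreal (1 / n)"
    by (simp add: divide_right_mono flip: diff_divide_distrib)
  ultimately show "ennreal (1 / n) \<le> emeasure unit_lborel ({0..1} \<inter> cell n -` {j})"
    using b by (simp add: emeasure_unit_lborel)
qed

section \<open>Homomorphism integrals with one function per edge\<close>

context edge_system
begin

definition hom_int :: "('v \<times> 'v \<Rightarrow> real \<times> real \<Rightarrow> complex) \<Rightarrow> complex" where
  "hom_int F = (\<integral>x. (\<Prod>e\<in>E. F e (x (fst e), x (snd e))) \<partial>cube_lebesgue V)"

lemma E_in_V: "e \<in> E \<Longrightarrow> fst e \<in> V" "e \<in> E \<Longrightarrow> snd e \<in> V"
  using E_sub by auto

lemma measurable_hom_prod: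
  fixes F :: "'v \<times> 'v \<Rightarrow> real \<times> real \<Rightarrow> complex"
  assumes "\<And>e. e \<in> E \<Longrightarrow> F e \<in> borel_measurable (lebesgue_on unit_square)"
  shows "(\<lambda>x. \<Prod>e\<in>E. F e (x (fst e), x (snd e))) \<in> borel_measurable (cube_lebesgue V)"
  using assms by (intro borel_measurable_prod measurable_cube_lebesgue_pair finite_V E_in_V loopless)

lemma norm_hom_prod_le:
  fixes F :: "'v \<times> 'v \<Rightarrow> real \<times> real \<Rightarrow> complex"
  assumes "\<And>e p. e \<in> E \<Longrightarrow> p \<in> unit_square \<Longrightarrow> cmod (F e p) \<le> K"
    and "x \<in> space (cube_lebesgue V)"
  shows "cmod (\<Prod>e\<in>E. F e (x (fst e), x (snd e))) \<le> K ^ m"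
proof -
  have "cmod (\<Prod>e\<in>E. F e (x (fst e), x (snd e))) \<le> (\<Prod>e\<in>E. K)"
    unfolding prod_norm[symmetric] using assms E_in_V
    by (intro prod_mono) (auto simp: space_cube_lebesgue PiE_iff)
  then show ?thesis by simp
qed

lemma bdd_measD:
  fixes f :: "real \<times> real \<Rightarrow> complex"
  assumes "f \<in> bdd_meas"
  shows "f \<in> borel_measurable (lebesgue_on unit_square)" "\<exists>K. \<forall>p\<in>unit_square. cmod (f p) \<le> K"
  using assms by (auto simp: bdd_meas_def bounded_iff)

lemma uniform_bound:
  fixes F :: "'v \<times> 'v \<Rightarrow> real \<times> real \<Rightarrow> complex"
  assumes "\<And>e. e \<in> E \<Longrightarrow> F e \<in> bdd_meas"
  obtains K where "0 \<le> K" "\<And>e p. e \<in> E \<Longrightarrow> p \<in> unit_square \<Longrightarrow> cmod (F e p) \<le> K"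
proof -
  obtain k where k: "\<And>e p. e \<in> E \<Longrightarrow> p \<in> unit_square \<Longrightarrow> cmod (F e p) \<le> k e"
    using bdd_measD(2)[OF assms] by metis
  show thesis
  proof
    show "0 \<le> (\<Sum>e\<in>E. \<bar>k e\<bar>)" by (simp add: sum_nonneg)
    fix e p assume e: "e \<in> E" and p: "p \<in> unit_square"
    have "cmod (F e p) \<le> \<bar>k e\<bar>" using k[OF e p] by simp
    also have "\<dots> \<le> (\<Sum>e\<in>E. \<bar>k e\<bar>)" using finite_E e by (intro member_le_sum) auto
    finally show "cmod (F e p) \<le> (\<Sum>e\<in>E. \<bar>k e\<bar>)" .
  qed
qed

lemma integrable_hom_prod:
  fixes F :: "'v \<times> 'v \<Rightarrow> real \<times> real \<Rightarrow> complex"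
  assumes "\<And>e. e \<in> E \<Longrightarrow> F e \<in> bdd_meas"
  shows "integrable (cube_lebesgue V) (\<lambda>x. \<Prod>e\<in>E. F e (x (fst e), x (snd e)))"
proof -
  interpret prob_space "cube_lebesgue V" by (rule prob_space_cube_lebesgue)
  obtain K where "0 \<le> K" "\<And>e p. e \<in> E \<Longrightarrow> p \<in> unit_square \<Longrightarrow> cmod (F e p) \<le> K"
    using uniform_bound[of F, OF assms] by blast
  then show ?thesis
    using assms by (intro integrable_const_bound[where B = "K ^ m"] AE_I2 norm_hom_prod_le measurable_hom_prod bdd_measD)
qed

text \<open>Dominated convergence with the constant \<open>K ^ m\<close> on a probability space.
  Convergence almost everywhere on the square passes to the cube along each of the finitely many
  edges.\<close>

lemma hom_int_tendsto:
  fixes F :: "'v \<times> 'v \<Rightarrow> real \<times> real \<Rightarrow> complex"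
  assumes meas: "\<And>e. e \<in> E \<Longrightarrow> F e \<in> borel_measurable (lebesgue_on unit_square)"
    and meas': "\<And>k e. e \<in> E \<Longrightarrow> G k e \<in> borel_measurable (lebesgue_on unit_square)"
    and bound: "\<And>k e p. e \<in> E \<Longrightarrow> p \<in> unit_square \<Longrightarrow> cmod (G k e p) \<le> K"
    and lim: "\<And>e. e \<in> E \<Longrightarrow> AE p in lebesgue_on unit_square. (\<lambda>k. G k e p) \<longlonglongrightarrow> F e p"
  shows "(\<lambda>k. hom_int (G k)) \<longlonglongrightarrow> hom_int F"
proof -
  interpret prob_space "cube_lebesgue V" by (rule prob_space_cube_lebesgue)
  have "AE x in cube_lebesgue V. \<forall>e\<in>E. (\<lambda>k. G k e (x (fst e), x (snd e))) \<longlonglongrightarrow> F e (x (fst e), x (snd e))"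
    using lim finite_E
    by (intro AE_finite_allI AE_cube_lebesgue_pair finite_V E_in_V loopless)
  then have "AE x in cube_lebesgue V. (\<lambda>k. \<Prod>e\<in>E. G k e (x (fst e), x (snd e)))
      \<longlonglongrightarrow> (\<Prod>e\<in>E. F e (x (fst e), x (snd e)))"
    by (rule eventually_mono) (intro tendsto_prod, blast)
  then show ?thesis
    unfolding hom_int_def
    by (intro integral_dominated_convergence[where w = "\<lambda>_. K ^ m", OF _ _ _ _ AE_I2]
        measurable_hom_prod meas meas' norm_hom_prod_le bound) auto
qed

lemma hom_int_sum:
  assumes "finite I" and W: "\<And>s e. s \<in> I \<Longrightarrow> e \<in> E \<Longrightarrow> W s e \<in> bdd_meas"
  shows "hom_int (\<lambda>e p. \<Sum>s\<in>I. W s e p) = (\<Sum>\<phi>\<in>E \<rightarrow>\<^sub>E I. hom_int (\<lambda>e. W (\<phi> e) e))"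
proof -
  have "hom_int (\<lambda>e p. \<Sum>s\<in>I. W s e p) =
      (\<integral>x. (\<Sum>\<phi>\<in>E \<rightarrow>\<^sub>E I. \<Prod>e\<in>E. W (\<phi> e) e (x (fst e), x (snd e))) \<partial>cube_lebesgue V)"
    unfolding hom_int_def
    by (intro Bochner_Integration.integral_cong refl prod_sum_PiE finite_E) (use assms in auto)
  also have "\<dots> = (\<Sum>\<phi>\<in>E \<rightarrow>\<^sub>E I. hom_int (\<lambda>e. W (\<phi> e) e))"
    unfolding hom_int_def by (intro Bochner_Integration.integral_sum integrable_hom_prod W) auto
  finally show ?thesis .
qed

lemma hom_int_scale: "hom_int (\<lambda>e p. c e * F e p) = (\<Prod>e\<in>E. c e) * hom_int F"
  by (simp add: hom_int_def prod.distrib)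

text \<open>The cube splits into boxes, one for each assignment of grid cells to vertices. On each
  box the integrand is constant, and its volume is \<open>(1 / n) ^ card V\<close>.\<close>

lemma hom_int_step_fun:
  assumes n: "0 < n"
  shows "hom_int (\<lambda>e. step_fun n (F e)) = of_real ((1 / n) ^ card V) * T n F"
proof -
  let ?P = "Pi\<^sub>M V (\<lambda>_. unit_lborel)"
  define Q where "Q z = (\<Pi>\<^sub>E v\<in>V. {0..1} \<inter> cell n -` {z v})" for z :: "'v \<Rightarrow> nat"
  interpret product_sigma_finite "\<lambda>_ :: 'v. unit_lborel"
    unfolding product_sigma_finite_def
    by (intro allI prob_space_imp_sigma_finite prob_space_unit_lborel)
  have cell_sets: "{0..1} \<inter> cell n -` {j} \<in> sets unit_lborel" for j
    using measurable_sets[OF measurable_cell, of "{j}" n] by (auto simp: sets_restrict_space)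
  have Q_sets: "Q z \<in> sets ?P" for z
    unfolding Q_def using finite_V cell_sets by (intro sets_PiM_I_finite) auto
  have Q_meas: "emeasure ?P (Q z) = ennreal ((1 / n) ^ card V)" if "z \<in> V \<rightarrow>\<^sub>E {..<n}" for z
  proof -
    have "emeasure ?P (Q z) = (\<Prod>v\<in>V. emeasure unit_lborel ({0..1} \<inter> cell n -` {z v}))"
      unfolding Q_def using finite_V cell_sets by (intro emeasure_PiM)
    also have "\<dots> = (\<Prod>v\<in>V. ennreal (1 / n))"
      using that by (intro prod.cong refl emeasure_cell) auto
    finally show ?thesis by (simp add: ennreal_power)
  qed
  let ?t = "\<lambda>z. \<Prod>e\<in>E. F e (z (fst e)) (z (snd e))"
  have "hom_int (\<lambda>e. step_fun n (F e)) =
    (\<integral>x. (\<Sum>z \<in> V \<rightarrow>\<^sub>E {..<n}. indicator (Q z) x *\<^sub>R ?t z) \<partial>cube_lebesgue V)"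
    unfolding hom_int_def
  proof (intro Bochner_Integration.integral_cong refl)
    fix x assume "x \<in> space (cube_lebesgue V)"
    then have x: "x \<in> V \<rightarrow>\<^sub>E {0..1}" by (simp add: space_cube_lebesgue)
    \<comment> \<open>The index of the unique box that contains \<open>x\<close>.\<close>
    define z where "z = (\<lambda>v\<in>V. cell n (x v))"
    have z: "z \<in> V \<rightarrow>\<^sub>E {..<n}" by (auto simp: z_def cell_less n)
    have mem: "x \<in> Q z' \<longleftrightarrow> z' = z" if "z' \<in> V \<rightarrow>\<^sub>E {..<n}" for z'
      using x that by (fastforce simp: Q_def z_def PiE_iff extensional_def fun_eq_iff)
    have "(\<Sum>z' \<in> V \<rightarrow>\<^sub>E {..<n}. indicator (Q z') x *\<^sub>R ?t z') = (\<Sum>z' \<in> V \<rightarrow>\<^sub>E {..<n}. if z' = z then ?t z' else 0)"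
      using mem by (intro sum.cong refl) (simp add: indicator_def)
    also have "\<dots> = ?t z" using z finite_V by (simp add: finite_PiE)
    also have "\<dots> = (\<Prod>e\<in>E. step_fun n (F e) (x (fst e), x (snd e)))"
      using E_in_V by (intro prod.cong refl) (simp add: z_def step_fun_def)
    finally show "(\<Prod>e\<in>E. step_fun n (F e) (x (fst e), x (snd e))) =
        (\<Sum>z' \<in> V \<rightarrow>\<^sub>E {..<n}. indicator (Q z') x *\<^sub>R ?t z')" ..
  qed
  also have "\<dots> = (\<integral>x. (\<Sum>z \<in> V \<rightarrow>\<^sub>E {..<n}. indicator (Q z) x *\<^sub>R ?t z) \<partial>?P)"
    unfolding cube_lebesgue_def by (intro integral_completion borel_measurable_sum borel_measurable_scaleR
        borel_measurable_indicator borel_measurable_const Q_sets)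
  also have "\<dots> = (\<Sum>z \<in> V \<rightarrow>\<^sub>E {..<n}. (1 / n) ^ card V *\<^sub>R ?t z)"
    using Q_sets Q_meas
    by (subst Bochner_Integration.integral_sum) (auto simp: measure_def intro!: sum.cong integrable_scaleR_left)
  also have "\<dots> = of_real ((1 / n) ^ card V) * T n F"
    by (simp add: hom_sum_def sum_distrib_left scaleR_conv_of_real)
  finally show ?thesis .
qed

end

section \<open>Bounded measurable functions under conjugation and approximation\<close>

lemma conj_unless_tendsto:
  "(f \<longlongrightarrow> l) F \<Longrightarrow> ((\<lambda>x. conj_unless b (f x)) \<longlongrightarrow> conj_unless b l) F"
  by (cases b) (auto intro: tendsto_cnj)

lemma borel_measurable_conj_unless:
  "f \<in> borel_measurable M \<Longrightarrow> (\<lambda>x. conj_unless b (f x)) \<in> borel_measurable M"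
  by (cases b) (auto simp: conj_unless_def borel_measurable_complex_iff)

lemma bdd_meas_iff:
  "f \<in> bdd_meas \<longleftrightarrow> f \<in> borel_measurable (lebesgue_on unit_square) \<and> (\<exists>K. \<forall>p\<in>unit_square. norm (f p) \<le> K)"
  by (auto simp: bdd_meas_def bounded_iff)

lemma bdd_measI:
  "f \<in> borel_measurable (lebesgue_on unit_square) \<Longrightarrow> (\<And>p. p \<in> unit_square \<Longrightarrow> norm (f p) \<le> K) \<Longrightarrow> f \<in> bdd_meas"
  by (auto simp: bdd_meas_iff)

lemma bdd_meas_conj_unless: "f \<in> bdd_meas \<Longrightarrow> (\<lambda>p. conj_unless b (f p)) \<in> bdd_meas"
  by (auto simp: bdd_meas_iff borel_measurable_conj_unless)

lemma bdd_meas_mult_left: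
  fixes f :: "real \<times> real \<Rightarrow> complex"
  shows "f \<in> bdd_meas \<Longrightarrow> (\<lambda>p. c * f p) \<in> bdd_meas"
  by (auto simp: bdd_meas_iff norm_mult intro!: exI[of _ "cmod c * _"] mult_left_mono)

lemma measurable_lebesgue_on_borel:
  "f \<in> borel_measurable borel \<Longrightarrow> f \<in> borel_measurable (lebesgue_on S)"
  by (intro measurable_restrict_space1 measurable_completion) simp

lemma bdd_meas_step_fun: "step_fun n a \<in> bdd_meas"
proof (rule bdd_measI)
  show "step_fun n a \<in> borel_measurable (lebesgue_on unit_square)"
    by (rule measurable_lebesgue_on_borel[OF measurable_step_fun])
  fix p :: "real \<times> real"
  \<comment> \<open>Only finitely many entries occur as values, and the sum of their moduli is a
    bound; this form also covers \<open>n = 0\<close>.\<close>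
  have "cell n x \<le> n" for x by (simp add: cell_def)
  then have "cmod (step_fun n a p) \<le> (\<Sum>j\<le>n. cmod (a (cell n (fst p)) j))"
    unfolding step_fun_def by (intro member_le_sum[of _ _ "\<lambda>j. cmod (a _ j)"]) auto
  also have "\<dots> \<le> (\<Sum>i\<le>n. \<Sum>j\<le>n. cmod (a i j))"
    using \<open>\<And>x. cell n x \<le> n\<close>
    by (intro member_le_sum[of _ _ "\<lambda>i. \<Sum>j\<le>n. cmod (a i j)"]) (auto intro: sum_nonneg)
  finally show "cmod (step_fun n a p) \<le> (\<Sum>i\<le>n. \<Sum>j\<le>n. cmod (a i j))" .
qed

lemma cell_tendsto:
  assumes x: "x \<in> {0..1}"
  shows "(\<lambda>k. real (cell (Suc k) x) / real (Suc k)) \<longlonglongrightarrow> x"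
proof (rule tendsto_sandwich)
  have "x \<le> (real (cell (Suc k) x) + 1) / real (Suc k)" "real (cell (Suc k) x) / real (Suc k) \<le> x" for k
    using cell_bounds[OF _ x, of "Suc k"] by (simp_all only: pos_le_divide_eq pos_divide_le_eq mult.commute of_nat_0_less_iff)
  then have "x - 1 / real (Suc k) \<le> real (cell (Suc k) x) / real (Suc k)"
    "real (cell (Suc k) x) / real (Suc k) \<le> x" for k
    by (simp_all only: add_divide_distrib diff_le_eq)
  then show "\<forall>\<^sub>F k in sequentially. x - 1 / real (Suc k) \<le> real (cell (Suc k) x) / real (Suc k)"
    "\<forall>\<^sub>F k in sequentially. real (cell (Suc k) x) / real (Suc k) \<le> x" by auto
  have "(\<lambda>k. x - 1 / real (Suc k)) \<longlonglongrightarrow> x - 0"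
    using LIMSEQ_inverse_real_of_nat by (intro tendsto_intros) (simp add: inverse_eq_divide)
  then show "(\<lambda>k. x - 1 / real (Suc k)) \<longlonglongrightarrow> x" by simp
qed simp

section \<open>The Hoelder inequality, from step functions to bounded measurable functions\<close>

context edge_system
begin

definition t_fun :: "('v \<times> 'v \<Rightarrow> bool) \<Rightarrow> (real \<times> real \<Rightarrow> complex) \<Rightarrow> complex" where
  "t_fun \<alpha> f = hom_int (\<lambda>e p. conj_unless (\<alpha> e) (f p))"

definition t_real :: "(real \<times> real \<Rightarrow> real) \<Rightarrow> real" where
  "t_real f = (\<integral>x. (\<Prod>e\<in>E. f (x (fst e), x (snd e))) \<partial>cube_lebesgue V)"

lemma hom_int_of_real: "hom_int (\<lambda>e p. of_real (f p)) = of_real (t_real f)"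
  unfolding hom_int_def t_real_def of_real_prod[symmetric] by (rule integral_complex_of_real)

lemma t_fun_tendsto:
  assumes "f \<in> borel_measurable (lebesgue_on unit_square)"
    and "\<And>k. g k \<in> borel_measurable (lebesgue_on unit_square)"
    and "\<And>k p. p \<in> unit_square \<Longrightarrow> cmod (g k p) \<le> K"
    and "AE p in lebesgue_on unit_square. (\<lambda>k. g k p) \<longlonglongrightarrow> f p"
  shows "(\<lambda>k. t_fun \<alpha> (g k)) \<longlonglongrightarrow> t_fun \<alpha> f"
  unfolding t_fun_def using assms
  by (intro hom_int_tendsto[where K = K] borel_measurable_conj_unless)
    (auto intro: conj_unless_tendsto elim: eventually_mono)

definition hoelder :: "('v \<times> 'v \<Rightarrow> bool) \<Rightarrow> ('v \<times> 'v \<Rightarrow> real \<times> real \<Rightarrow> complex) \<Rightarrow> bool" where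
  "hoelder \<alpha> F \<longleftrightarrow> cmod (hom_int F) ^ m \<le> (\<Prod>e\<in>E. cmod (t_fun \<alpha> (F e)))"

text \<open>Both sides are continuous under uniformly bounded convergence almost everywhere, so the
  inequality passes to the limit.\<close>

lemma hoelder_limit:
  assumes "\<And>k. hoelder \<alpha> (G k)"
    and "\<And>e. F e \<in> borel_measurable (lebesgue_on unit_square)"
    and "\<And>k e. G k e \<in> borel_measurable (lebesgue_on unit_square)"
    and "\<And>k e p. p \<in> unit_square \<Longrightarrow> cmod (G k e p) \<le> K"
    and "\<And>e. AE p in lebesgue_on unit_square. (\<lambda>k. G k e p) \<longlonglongrightarrow> F e p"
  shows "hoelder \<alpha> F"
  unfolding hoelder_def
proof (rule LIMSEQ_le)
  show "(\<lambda>k. cmod (hom_int (G k)) ^ m) \<longlonglongrightarrow> cmod (hom_int F) ^ m"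
    using assms by (intro tendsto_power tendsto_norm hom_int_tendsto[where K = K])
  show "(\<lambda>k. \<Prod>e\<in>E. cmod (t_fun \<alpha> (G k e))) \<longlonglongrightarrow> (\<Prod>e\<in>E. cmod (t_fun \<alpha> (F e)))"
    using assms by (intro tendsto_prod tendsto_norm t_fun_tendsto[where K = K])
qed (use assms(1) in \<open>auto simp: hoelder_def\<close>)

text \<open>Both sides carry the same volume factor: the m-th power of \<open>?c\<close> on the
  left, one \<open>?c\<close> for each of the \<open>m\<close> edges on the right.\<close>

lemma hoelder_step_fun:
  assumes opt: "\<And>a. cmod (t_col \<alpha> n a) = max_col n a"
    and bound: "\<And>F. cmod (T n F) ^ m \<le> (\<Prod>e\<in>E. max_col n (F e))"
    and n: "0 < n"
  shows "hoelder \<alpha> (\<lambda>e. step_fun n (F e))"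
proof -
  let ?c = "(1 / n) ^ card V"
  have t: "t_fun \<alpha> (step_fun n a) = of_real ?c * t_col \<alpha> n a" for a
    using hom_int_step_fun[OF n, of "\<lambda>e. conj_mat (\<alpha> e) a"]
    by (simp add: t_fun_def t_col_def step_fun_def[abs_def] conj_mat_def)
  have "cmod (hom_int (\<lambda>e. step_fun n (F e))) ^ m = ?c ^ m * cmod (T n F) ^ m"
    unfolding hom_int_step_fun[OF n] norm_mult power_mult_distrib norm_of_real by simp
  also have "\<dots> \<le> ?c ^ m * (\<Prod>e\<in>E. max_col n (F e))"
    using bound by (intro mult_left_mono) auto
  also have "\<dots> = (\<Prod>e\<in>E. ?c * cmod (t_col \<alpha> n (F e)))"
    unfolding opt by (simp add: prod.distrib)
  also have "\<dots> = (\<Prod>e\<in>E. cmod (t_fun \<alpha> (step_fun n (F e))))"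
    unfolding t norm_mult norm_of_real by simp
  finally show ?thesis by (simp add: hoelder_def)
qed

text \<open>Sampling \<open>F e\<close> at the lower left corners of finer and finer grids gives
  step functions that converge pointwise on the square.\<close>

lemma hoelder_continuous:
  fixes F :: "'v \<times> 'v \<Rightarrow> real \<times> real \<Rightarrow> complex"
  assumes step: "\<And>n F. 0 < n \<Longrightarrow> hoelder \<alpha> (\<lambda>e. step_fun n (F e))"
    and cont: "\<And>e. continuous_on UNIV (F e)" and bound: "\<And>e p. cmod (F e p) \<le> K"
  shows "hoelder \<alpha> F"
proof (rule hoelder_limit)
  let ?a = "\<lambda>k e i j. F e (real i / real (Suc k), real j / real (Suc k))"
  show "hoelder \<alpha> (\<lambda>e. step_fun (Suc k) (?a k e))" for k by (rule step) simp
  show "F e \<in> borel_measurable (lebesgue_on unit_square)" for e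
    using cont by (intro measurable_lebesgue_on_borel borel_measurable_continuous_onI)
  show "step_fun (Suc k) (?a k e) \<in> borel_measurable (lebesgue_on unit_square)" for k e
    by (rule measurable_lebesgue_on_borel[OF measurable_step_fun])
  show "cmod (step_fun (Suc k) (?a k e) p) \<le> K" for k e p
    by (simp add: step_fun_def bound)
  have "(\<lambda>k. step_fun (Suc k) (?a k e) p) \<longlonglongrightarrow> F e p" if "p \<in> unit_square" for e p
  proof -
    have "isCont (F e) p" using cont[of e] continuous_on_eq_continuous_at[of UNIV "F e"] by blast
    moreover have "(\<lambda>k. (real (cell (Suc k) (fst p)) / real (Suc k), real (cell (Suc k) (snd p)) / real (Suc k)))
        \<longlonglongrightarrow> (fst p, snd p)"
      using that by (intro tendsto_Pair cell_tendsto) auto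
    ultimately show ?thesis unfolding step_fun_def by (intro isCont_tendsto_compose[of p "F e"]) auto
  qed
  then show "AE p in lebesgue_on unit_square. (\<lambda>k. step_fun (Suc k) (?a k e) p) \<longlonglongrightarrow> F e p" for e
    by (intro AE_I2) (simp add: space_restrict_space)
qed

text \<open>Measurable functions are limits almost everywhere of continuous ones, but these need not
  be uniformly bounded. Projecting their values to a disc restores a common bound.\<close>

lemma hoelder_bdd_meas:
  fixes F :: "'v \<times> 'v \<Rightarrow> real \<times> real \<Rightarrow> complex"
  assumes step: "\<And>n F. 0 < n \<Longrightarrow> hoelder \<alpha> (\<lambda>e. step_fun n (F e))"
    and F: "\<And>e. F e \<in> bdd_meas"
  shows "hoelder \<alpha> F"
proof -
  obtain K where K: "0 \<le> K" "\<And>e p. e \<in> E \<Longrightarrow> p \<in> unit_square \<Longrightarrow> cmod (F e p) \<le> K"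
    using uniform_bound[of F, OF F] by blast
  have "\<forall>e. \<exists>N g. negligible N \<and> (\<forall>k. continuous_on UNIV (g k)) \<and>
      (\<forall>p. p \<notin> N \<longrightarrow> (\<lambda>k. g k p) \<longlonglongrightarrow> (if p \<in> unit_square then F e p else 0))"
    using F unit_square_lebesgue measurable_on_iff_borel_measurable
    unfolding measurable_on_def bdd_meas_def by fast
  then obtain N g where N: "\<And>e. negligible (N e)" and g: "\<And>e k. continuous_on UNIV (g e k)"
    and lim: "\<And>e p. p \<notin> N e \<Longrightarrow> (\<lambda>k. g e k p) \<longlonglongrightarrow> (if p \<in> unit_square then F e p else 0)"
    by metis
  \<comment> \<open>Nearest-point projection to the disc of radius \<open>K\<close>: continuous, and
    the identity on the values that \<open>F e\<close> takes on the square for \<open>e\<close> in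
    \<open>E\<close>.\<close>
  define clip :: "complex \<Rightarrow> complex" where "clip = closest_point (cball 0 K)"
  have clip_cont: "continuous_on UNIV clip"
    unfolding clip_def using K(1) by (intro continuous_on_closest_point) auto
  have clip_norm: "cmod (clip z) \<le> K" for z
    using closest_point_in_set[of "cball 0 K" z] K(1) by (simp add: clip_def)
  have clip_id: "clip z = z" if "cmod z \<le> K" for z
    using that by (simp add: clip_def closest_point_self)
  \<comment> \<open>The bound \<open>K\<close> is known on \<open>E\<close> only, while
    \<open>hoelder_limit\<close> asks for convergence at every index; outside \<open>E\<close> the
    functions are set to 0.\<close>
  define F' where "F' e = (if e \<in> E then F e else (\<lambda>p. 0))" for e
  have "hoelder \<alpha> F'"
  proof (rule hoelder_limit)
    let ?G = "\<lambda>k e p. clip (if e \<in> E then g e k p else 0)"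
    have cont: "continuous_on UNIV (?G k e)" for k e
      using continuous_on_compose2[OF clip_cont g[of e k]] by (cases "e \<in> E") auto
    show "hoelder \<alpha> (?G k)" for k
      by (rule hoelder_continuous[OF step cont clip_norm])
    show "F' e \<in> borel_measurable (lebesgue_on unit_square)" for e
      using F by (simp add: F'_def bdd_meas_def)
    show "?G k e \<in> borel_measurable (lebesgue_on unit_square)" for k e
      using cont by (intro measurable_lebesgue_on_borel borel_measurable_continuous_onI)
    show "cmod (?G k e p) \<le> K" for k e p by (rule clip_norm)
    show "AE p in lebesgue_on unit_square. (\<lambda>k. ?G k e p) \<longlonglongrightarrow> F' e p" for e
    proof (cases "e \<in> E")
      case True
      have "(\<lambda>k. clip (g e k p)) \<longlonglongrightarrow> F e p" if "p \<notin> N e" "p \<in> unit_square" for p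
      proof -
        have "isCont clip (F e p)" using clip_cont by (simp add: continuous_on_eq_continuous_at)
        then have "(\<lambda>k. clip (g e k p)) \<longlonglongrightarrow> clip (F e p)"
          using lim[OF that(1)] that(2) by (intro isCont_tendsto_compose[of _ clip]) auto
        then show ?thesis using K(2)[OF True that(2)] by (simp add: clip_id)
      qed
      moreover have "AE p in lebesgue. p \<notin> N e"
        using N by (intro AE_not_in) (simp add: negligible_iff_null_sets)
      ultimately show ?thesis
        using True unit_square_lebesgue by (subst AE_restrict_space_iff) (auto simp: F'_def elim: eventually_mono)
    next
      case False
      then show ?thesis using K(1) by (simp add: F'_def clip_id)
    qed
  qed
  moreover have "hom_int F' = hom_int F" unfolding hom_int_def F'_def
    by (intro Bochner_Integration.integral_cong prod.cong) auto
  moreover have "(\<Prod>e\<in>E. cmod (t_fun \<alpha> (F' e))) = (\<Prod>e\<in>E. cmod (t_fun \<alpha> (F e)))"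
    by (intro prod.cong) (auto simp: F'_def)
  ultimately show ?thesis by (simp add: hoelder_def)
qed

end

section \<open>The norm axioms from the Hoelder inequality\<close>

context edge_system
begin

lemma t_fun_cnj: "cmod (t_fun \<alpha> (\<lambda>p. conj_unless b (f p))) = cmod (t_fun \<alpha> f)"
proof (cases b)
  case False
  have "t_fun \<alpha> (\<lambda>p. conj_unless b (f p)) =
      (\<integral>x. cnj (\<Prod>e\<in>E. conj_unless (\<alpha> e) (f (x (fst e), x (snd e)))) \<partial>cube_lebesgue V)"
    unfolding t_fun_def hom_int_def
    by (intro Bochner_Integration.integral_cong refl) (use False in \<open>auto simp: conj_unless_def intro!: prod.cong\<close>)
  also have "\<dots> = cnj (t_fun \<alpha> f)"
    unfolding t_fun_def hom_int_def by (rule Bochner_Integration.integral_cnj)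
  finally have "t_fun \<alpha> (\<lambda>p. conj_unless b (f p)) = cnj (t_fun \<alpha> f)" .
  then show ?thesis by simp
qed simp

lemma cmod_t_fun_scale: "cmod (t_fun \<alpha> (\<lambda>p. c * f p)) = cmod c ^ m * cmod (t_fun \<alpha> f)"
  by (simp add: t_fun_def conj_unless_mult hom_int_scale norm_mult flip: prod_norm)

lemma cmod_hom_int_le_root:
  assumes "hoelder \<alpha> F"
  shows "cmod (hom_int F) \<le> (\<Prod>e\<in>E. root m (cmod (t_fun \<alpha> (F e))))"
\<comment> \<open>The rule compares powers with a successor exponent, hence \<open>m\<close> is
  written as \<open>Suc (m - 1)\<close>.\<close>
proof (rule power_le_imp_le_base[of _ "m - 1"])
  have "(\<Prod>e\<in>E. root m (cmod (t_fun \<alpha> (F e)))) ^ m = (\<Prod>e\<in>E. cmod (t_fun \<alpha> (F e)))"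
    using m_pos by (simp add: prod_power_distrib)
  then show "cmod (hom_int F) ^ Suc (m - 1) \<le> (\<Prod>e\<in>E. root m (cmod (t_fun \<alpha> (F e)))) ^ Suc (m - 1)"
    using assms m_pos by (simp add: hoelder_def)
  show "0 \<le> (\<Prod>e\<in>E. root m (cmod (t_fun \<alpha> (F e))))"
    by (intro prod_nonneg real_root_ge_zero norm_ge_zero)
qed

text \<open>Expand the integral of \<open>f + g\<close> over all choices of \<open>f\<close> or
  \<open>g\<close> per edge. Hoelder bounds each term by a product of norms, and these products sum
  to the m-th power of the sum of the two norms.\<close>

lemma t_fun_triangle:
  assumes hoelder: "\<And>F. (\<And>e. F e \<in> bdd_meas) \<Longrightarrow> hoelder \<alpha> F"
    and f: "f \<in> bdd_meas" and g: "g \<in> bdd_meas"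
  shows "root m (cmod (t_fun \<alpha> (\<lambda>p. f p + g p))) \<le> root m (cmod (t_fun \<alpha> f)) + root m (cmod (t_fun \<alpha> g))"
proof -
  define h where "h b = (if b then f else g)" for b
  let ?N = "\<lambda>f. root m (cmod (t_fun \<alpha> f))"
  have h: "h b \<in> bdd_meas" for b using f g by (simp add: h_def)
  have "t_fun \<alpha> (\<lambda>p. f p + g p) = hom_int (\<lambda>e p. \<Sum>b\<in>UNIV. conj_unless (\<alpha> e) (h b p))"
    by (simp add: t_fun_def h_def UNIV_bool conj_unless_add add.commute)
  also have "\<dots> = (\<Sum>\<phi>\<in>colourings. hom_int (\<lambda>e p. conj_unless (\<alpha> e) (h (\<phi> e) p)))"
    using h by (intro hom_int_sum bdd_meas_conj_unless) auto
  also have "cmod \<dots> \<le> (\<Sum>\<phi>\<in>colourings. \<Prod>e\<in>E. ?N (h (\<phi> e)))"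
  proof (intro order.trans[OF norm_sum] sum_mono)
    fix \<phi> :: "'v \<times> 'v \<Rightarrow> bool"
    show "cmod (hom_int (\<lambda>e p. conj_unless (\<alpha> e) (h (\<phi> e) p))) \<le> (\<Prod>e\<in>E. ?N (h (\<phi> e)))"
      \<comment> \<open>Each factor on the right involves one function only, where a conjugation
        does not affect the modulus; thus the colours disappear from the bound.\<close>
      using cmod_hom_int_le_root[OF hoelder, of "\<lambda>e p. conj_unless (\<alpha> e) (h (\<phi> e) p)"] h
      by (simp add: t_fun_cnj bdd_meas_conj_unless)
  qed
  also have "\<dots> = (\<Prod>e\<in>E. \<Sum>b\<in>UNIV. ?N (h b))"
    using finite_E by (intro prod_sum_PiE[symmetric]) auto
  also have "\<dots> = (?N f + ?N g) ^ m" by (simp add: UNIV_bool h_def add.commute)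
  finally have "root m (cmod (t_fun \<alpha> (\<lambda>p. f p + g p))) \<le> root m ((?N f + ?N g) ^ m)"
    using m_pos by simp
  also have "\<dots> = ?N f + ?N g" using m_pos by (intro real_root_power_cancel) auto
  finally show ?thesis .
qed

text \<open>If \<alpha> gives 0, Hoelder makes every colouring give 0. The sum over all colourings
  is the integral for \<open>f\<close> plus its conjugate, which is twice the real part.\<close>

lemma t_fun_eq_0_imp:
  assumes hoelder: "\<And>F. (\<And>e. F e \<in> bdd_meas) \<Longrightarrow> hoelder \<alpha> F"
    and f: "f \<in> bdd_meas" and zero: "t_fun \<alpha> f = 0"
  shows "t_real (\<lambda>p. Re (f p)) = 0"
proof -
  have "hom_int (\<lambda>e p. conj_unless (\<phi> e) (f p)) = 0" for \<phi>
    using cmod_hom_int_le_root[OF hoelder, of "\<lambda>e p. conj_unless (\<phi> e) (f p)"] f finite_E E_ne zero m_pos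
    by (simp add: t_fun_cnj bdd_meas_conj_unless zero_power)
  then have "(\<Sum>\<phi>\<in>colourings. hom_int (\<lambda>e p. conj_unless (\<phi> e) (f p))) = 0" by simp
  also have "(\<Sum>\<phi>\<in>colourings. hom_int (\<lambda>e p. conj_unless (\<phi> e) (f p))) =
      hom_int (\<lambda>e p. \<Sum>b\<in>UNIV. conj_unless b (f p))"
    using f by (intro hom_int_sum[symmetric] bdd_meas_conj_unless) auto
  also have "\<dots> = hom_int (\<lambda>e p. 2 * of_real (Re (f p)))"
    by (simp add: UNIV_bool complex_add_cnj add.commute)
  also have "\<dots> = 2 ^ m * of_real (t_real (\<lambda>p. Re (f p)))"
    by (simp add: hom_int_scale hom_int_of_real)
  finally show ?thesis by simp
qed

lemma cmod_t_fun_le: "cmod (t_fun \<alpha> f) \<le> t_real (\<lambda>p. cmod (f p))"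
proof -
  have "cmod (t_fun \<alpha> f) \<le> (\<integral>x. cmod (\<Prod>e\<in>E. conj_unless (\<alpha> e) (f (x (fst e), x (snd e)))) \<partial>cube_lebesgue V)"
    unfolding t_fun_def hom_int_def by (rule integral_norm_bound)
  then show ?thesis by (simp add: t_real_def flip: prod_norm)
qed

text \<open>The real norm yields the matrix triangle inequality, hence an optimal colouring and its
  Hoelder inequality. Definiteness is taken from the real norm through real parts and
  moduli.\<close>

lemma norm_complex_if_norm_real:
  assumes "is_norm (\<lambda>f. root m \<bar>t_real f\<bar>)"
  shows "\<exists>\<alpha>. is_norm (\<lambda>f. root m (cmod (t_fun \<alpha> f)))"
proof -
  let ?R = "\<lambda>f. root m \<bar>t_real f\<bar>"
  have R_add: "?R (\<lambda>p. f p + g p) \<le> ?R f + ?R g" if "f \<in> bdd_meas" "g \<in> bdd_meas" for f g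
    using assms that unfolding is_norm_def by blast
  have R_zero: "t_real f = 0 \<longleftrightarrow> (AE p in lebesgue_on unit_square. f p = 0)" if "f \<in> bdd_meas" for f
    using assms that m_pos unfolding is_norm_def by (simp add: real_root_eq_0_iff)
  have Re_bdd: "(\<lambda>p. Re (f p)) \<in> bdd_meas" if "f \<in> bdd_meas" for f :: "real \<times> real \<Rightarrow> complex"
    using that by (auto simp: bdd_meas_iff intro: order_trans[OF abs_Re_le_cmod])
  have triangle: "root m (cmod (T n (\<lambda>e i j. a i j + b i j))) \<le>
      root m (cmod (T n (\<lambda>e. a))) + root m (cmod (T n (\<lambda>e. b)))"
    if n: "0 < n" and a: "\<And>i j. a i j \<in> \<real>" and b: "\<And>i j. b i j \<in> \<real>" for n a b
  proof -
    let ?c = "(1 / real n) ^ card V"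
    \<comment> \<open>The volume factor depends on \<open>n\<close> only and cancels from the
      triangle inequality.\<close>
    have T_eq: "?R (\<lambda>p. Re (step_fun n a p)) = root m ?c * root m (cmod (T n (\<lambda>e. a)))"
      if a: "\<And>i j. a i j \<in> \<real>" for a
    proof -
      have "complex_of_real (t_real (\<lambda>p. Re (step_fun n a p))) = of_real ?c * T n (\<lambda>e. a)"
        using hom_int_step_fun[OF n, of "\<lambda>e. a"] a
        by (simp add: step_fun_def[abs_def] flip: hom_int_of_real)
      then have "\<bar>t_real (\<lambda>p. Re (step_fun n a p))\<bar> = ?c * cmod (T n (\<lambda>e. a))"
        by (metis norm_mult norm_of_real abs_of_nonneg zero_le_power divide_nonneg_nonneg of_nat_0_le_iff zero_le_one)
      then show ?thesis by (simp add: real_root_mult)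
    qed
    have "root m ?c * root m (cmod (T n (\<lambda>e i j. a i j + b i j))) =
        ?R (\<lambda>p. Re (step_fun n a p) + Re (step_fun n b p))"
      using a b T_eq[of "\<lambda>i j. a i j + b i j"] by (simp add: step_fun_def)
    also have "\<dots> \<le> ?R (\<lambda>p. Re (step_fun n a p)) + ?R (\<lambda>p. Re (step_fun n b p))"
      by (intro R_add Re_bdd bdd_meas_step_fun)
    also have "\<dots> = root m ?c * (root m (cmod (T n (\<lambda>e. a))) + root m (cmod (T n (\<lambda>e. b))))"
      by (simp add: T_eq a b distrib_left)
    finally show ?thesis
      using n m_pos by (simp add: mult_le_cancel_left_pos)
  qed
  obtain \<alpha> where \<alpha>: "\<And>n a. 0 < n \<Longrightarrow> cmod (t_col \<alpha> n a) = max_col n a"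
    using optimal_colouring[OF triangle] by blast
  have "hoelder \<alpha> (\<lambda>e. step_fun n (F e))" if n: "0 < n" for n F
    by (intro hoelder_step_fun \<alpha> n T_le_max_col triangle)
  then have hoelder: "hoelder \<alpha> F" if "\<And>e. F e \<in> bdd_meas" for F
    using that by (rule hoelder_bdd_meas)
  have "t_fun \<alpha> f = 0 \<longleftrightarrow> (AE p in lebesgue_on unit_square. f p = 0)" if f: "f \<in> bdd_meas" for f
  proof
    assume zero: "t_fun \<alpha> f = 0"
    have Re0: "AE p in lebesgue_on unit_square. Re (g p) = 0" if "g \<in> bdd_meas" "t_fun \<alpha> g = 0" for g
      using t_fun_eq_0_imp[OF hoelder that] R_zero[OF Re_bdd[OF that(1)]] by simp
    \<comment> \<open>Multiplication by -i turns the imaginary part of \<open>f\<close> into a real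
      part, so the argument for real parts covers it as well.\<close>
    have "t_fun \<alpha> (\<lambda>p. - \<i> * f p) = 0"
      using cmod_t_fun_scale[of \<alpha> "- \<i>" f] zero by simp
    then have "AE p in lebesgue_on unit_square. Re (- \<i> * f p) = 0"
      by (intro Re0 bdd_meas_mult_left f)
    then show "AE p in lebesgue_on unit_square. f p = 0"
      using Re0[OF f zero] by eventually_elim (simp add: complex_eq_iff)
  next
    assume "AE p in lebesgue_on unit_square. f p = 0"
    \<comment> \<open>The real norm vanishes on the modulus of \<open>f\<close>, and the integral of
      the modulus dominates the coloured one.\<close>
    moreover have "(\<lambda>p. cmod (f p)) \<in> bdd_meas"
      using f by (auto simp: bdd_meas_iff intro: borel_measurable_norm)
    ultimately have "t_real (\<lambda>p. cmod (f p)) = 0" by (simp add: R_zero)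
    then show "t_fun \<alpha> f = 0" using cmod_t_fun_le[of \<alpha> f] by simp
  qed
  then have "is_norm (\<lambda>f. root m (cmod (t_fun \<alpha> f)))"
    unfolding is_norm_def
    using m_pos t_fun_triangle[OF hoelder]
    by (auto simp: cmod_t_fun_scale real_root_mult real_root_power_cancel real_root_eq_0_iff)
  then show ?thesis by (rule exI[of _ \<alpha>])
qed

text \<open>On real functions conjugation is the identity, so every colouring gives the uncoloured
  integral and the norm axioms restrict.\<close>

lemma norm_real_if_norm_complex:
  assumes "is_norm (\<lambda>f. root m (cmod (t_fun \<alpha> f)))"
  shows "is_norm (\<lambda>f. root m \<bar>t_real f\<bar>)"
proof -
  let ?N = "\<lambda>f. root m (cmod (t_fun \<alpha> f))"
  have emb: "(\<lambda>p. complex_of_real (f p)) \<in> bdd_meas" if "f \<in> bdd_meas" for f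
    using that by (auto simp: bdd_meas_iff intro: borel_measurable_of_real)
  have eq: "root m \<bar>t_real f\<bar> = ?N (\<lambda>p. of_real (f p))" for f
    by (simp add: t_fun_def hom_int_of_real)
  have add: "?N (\<lambda>p. f p + g p) \<le> ?N f + ?N g" if "f \<in> bdd_meas" "g \<in> bdd_meas" for f g
    using assms that unfolding is_norm_def by blast
  have scale: "?N (\<lambda>p. c * f p) = cmod c * ?N f" if "f \<in> bdd_meas" for c f
    using assms that unfolding is_norm_def by blast
  have zero: "?N f = 0 \<longleftrightarrow> (AE p in lebesgue_on unit_square. f p = 0)" if "f \<in> bdd_meas" for f
    using assms that unfolding is_norm_def by blast
  show ?thesis
    unfolding is_norm_def
  proof (intro conjI ballI allI)
    fix f g :: "real \<times> real \<Rightarrow> real" and c :: real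
    assume f: "f \<in> bdd_meas"
    show "0 \<le> root m \<bar>t_real f\<bar>" by (intro real_root_ge_zero abs_ge_zero)
    show "root m \<bar>t_real (\<lambda>p. c * f p)\<bar> = norm c * root m \<bar>t_real f\<bar>"
      using scale[OF emb[OF f], of "of_real c"] by (simp add: eq)
    show "root m \<bar>t_real f\<bar> = 0 \<longleftrightarrow> (AE p in lebesgue_on unit_square. f p = 0)"
      using zero[OF emb[OF f]] by (simp add: eq)
    assume g: "g \<in> bdd_meas"
    show "root m \<bar>t_real (\<lambda>p. f p + g p)\<bar> \<le> root m \<bar>t_real f\<bar> + root m \<bar>t_real g\<bar>"
      using add[OF emb[OF f] emb[OF g]] by (simp add: eq)
  qed
qed

end

section \<open>Bipartite graphs as edge systems and the equivalence of the two norming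
  properties\<close>

theorem theorem1p1:
  fixes A B :: "'v set" and E :: "('v \<times> 'v) set"
  assumes "bipartite_graph A B E"
  shows "complex_norming A B E \<longleftrightarrow> real_norming A B E"
proof -
  have G: "finite A" "finite B" "A \<inter> B = {}" "A \<union> B \<noteq> {}" "E \<subseteq> A \<times> B"
    "\<forall>w \<in> A \<union> B. \<exists>e \<in> E. w = fst e \<or> w = snd e"
    using assms by (auto simp: bipartite_graph_def)
  interpret edge_system "A \<union> B" E
  proof
    show "finite E" using G finite_subset by blast
    show "fst e \<noteq> snd e" if "e \<in> E" for e
      using G(3) subsetD[OF G(5) that] by auto
  qed (use G in auto)
  \<comment> \<open>For exponents in {0, 1} one of the two powers is 1, so each edge contributes
    either the value or its conjugate and a Boolean colour records which.\<close>
  have col: "t_hom_col A B E \<alpha> = t_fun (\<lambda>e. \<alpha> e = 1)" if "\<forall>e\<in>E. \<alpha> e \<in> {0, 1}" for \<alpha>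
  proof
    fix f :: "real \<times> real \<Rightarrow> complex"
    have "f (x (fst e), x (snd e)) ^ \<alpha> e * cnj (f (x (fst e), x (snd e))) ^ (1 - \<alpha> e) =
        conj_unless (\<alpha> e = 1) (f (x (fst e), x (snd e)))" if "e \<in> E" for e x
      using \<open>\<forall>e\<in>E. \<alpha> e \<in> {0, 1}\<close> that by (auto simp: conj_unless_def)
    then show "t_hom_col A B E \<alpha> f = t_fun (\<lambda>e. \<alpha> e = 1) f"
      unfolding t_hom_col_def t_fun_def hom_int_def
      by (intro Bochner_Integration.integral_cong prod.cong) (auto simp: case_prod_beta)
  qed
  have real: "t_hom A B E = t_real"
    by (simp add: t_hom_def t_real_def fun_eq_iff case_prod_beta)
  show ?thesis
  proof
    assume "complex_norming A B E"
    then obtain \<alpha> where "\<forall>e\<in>E. \<alpha> e \<in> {0, 1}" "complex_norming_col A B E \<alpha>"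
      unfolding complex_norming_def by blast
    then show "real_norming A B E"
      unfolding real_norming_def complex_norming_col_def real
      by (simp only: col) (rule norm_real_if_norm_complex)
  next
    assume "real_norming A B E"
    then obtain \<beta> where \<beta>: "is_norm (\<lambda>f. root m (cmod (t_fun \<beta> f)))"
      using norm_complex_if_norm_real unfolding real_norming_def real by blast
    let ?\<alpha> = "\<lambda>e. of_bool (\<beta> e) :: nat"
    have "complex_norming_col A B E ?\<alpha>"
      using \<beta> unfolding complex_norming_col_def by (subst col) auto
    then show "complex_norming A B E"
      unfolding complex_norming_def by (intro exI[of _ ?\<alpha>]) auto
  qed
qed

end
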